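(* Let $\mathcal R=(\mathcal F,\Pi,\mu,E,H,R)$ be an $E$-terminating EGTRS. If every conditional pair in $\mathsf{LCCP}(\mathcal R)\cup\mathsf{CVP}^{ps}(\mathcal R)\cup\mathsf{LCCP}(E,\mathcal R)\cup\mathsf{CVP}^{ps}(E)$ is joinable modulo $E$ w.r.t. $\to_{\mathcal R,E}$, then $\to_{\mathcal R}$ has the $\to_{\mathcal R,E}$-Church–Rosser property modulo $E$; consequently $\mathcal R$ is $E$-confluent.
   Context: Terms over a signature $\mathcal F$ and countable variables $\mathcal X$; $t|_p$, $t[s]_p$, root position $\Lambda$ standard. A replacement map $\mu$ assigns to each $k$-ary $f$ a set $\mu(f)\subseteq\{1,..,k\}$; active positions: $\mathcal{P}os^\mu(x)=\{\Lambda\}$, $\mathcal{P}os^\mu(f(t_1,..,t_k))=\{\Lambda\}\cup\{i.q\mid i\in\mu(f),q\in\mathcal{P}os^\mu(t_i)\}$; $\mathcal{P}os^\mu_{\mathcal F}(t)$ / $\mathcal{P}os^\mu_x(t)$ the active positions with a function symbol / the variable $x$; $\mathcal{V}ar^\mu(t)$ the variables with an active occurrence. An EGTRS is $\mathcal R=(\mathcal F,\Pi,\mu,E,H,R)$ with $\Pi$ a predicate signature containing binary $=,\to,\to^*$; $E$ conditional equations $s=t\Leftarrow c$; $H$ definite Horn clauses $A\Leftarrow c$ with head predicate not $=,\to,\to^*$; $R$ rules $\ell\to r\Leftarrow c$, $\ell\notin\mathcal X$; each $c$ a finite sequence of atoms; it is assumed that $=$ does not depend on $R$ (a predicate $P$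 depends on $R$ if $P\in\{\to,\to^*\}$ or some clause of $E\cup H$ with head predicate $P$ has a body atom whose predicate depends on $R$). $\overleftrightarrow E=\{s\to t\Leftarrow c,\ t\to s\Leftarrow c\mid s=t\Leftarrow c\in E\}$. $R^{rm}$: $R$ with $\approx$ replaced by new $\approx_{rm}$; $H^{rm}$: $H$ with $\approx,\to,\to^*$ replaced by new $\approx_{rm},\to_{rm},\to^*_{rm}$. $\mathsf{Th}^{CR}$: universal closures of (a) reflexivity, symmetry, transitivity of $=$, $x_i=y_i\Rightarrow f(..x_i..)=f(..y_i..)$ ($i\in\mu(f)$), $A_1\wedge..\wedge A_n\Rightarrow s=t$ for equations of $E$; (b) $x\to^*x$, $x\to y\wedge y\to^*z\Rightarrow x\to^*z$, $x_i\to y_i\Rightarrow f(..x_i..)\to f(..y_i..)$ ($i\in\mu(f)$), $A_1\wedge..\wedge A_n\Rightarrow\ell\to r$ for rules of $R^{rm}$; (c) $x\to^*_{ps}x$, $x\to_{ps}y\wedge y\to^*_{ps}z\Rightarrow x\to^*_{ps}z$, $\to_{ps}$-propagation for $i\in\mu(f)$, $x=\ell\wedge A_1\wedge..\wedge A_n\Rightarrow x\to_{ps}r$ ($x$ fresh) for rules of $R^{rm}$; (d) $x\to^*_{rm}x$, $x\to_{rm}y\wedge y\to^*_{rm}z\Rightarrow x\to^*_{rm}z$, $x=x'\wedge x'\to y'\wedge y'=y\Rightarrow x\to_{rm}y$; (e) the clauses of $H^{rm}$. $s\to_{\mathcal R}t$ / $s\to_{\mathcal R,E}t$ / $s\to_{\mathcal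 R/E}t$ iff $s\to t$ / $s\to_{ps}t$ / $s\to_{rm}t$ is deducible from $\mathsf{Th}^{CR}$; $s=_Et$ iff $s=t$ is deducible from (a) plus the clauses of $H$; $s\leftrightarrow_Et$ iff $s\to t$ is deducible from the theory of $x\to^*x$, $x\to y\wedge y\to^*z\Rightarrow x\to^*z$, $\to$-propagation for $i\in\mu(f)$, and $A_1\wedge..\wedge A_n\Rightarrow\lambda\to\rho$ for each $\lambda\to\rho\Leftarrow A_1,..,A_n\in\overleftrightarrow E$. $\mathcal R$ is $E$-terminating if there is no infinite $\to_{\mathcal R/E}$-sequence; $E$-confluent if whenever $t\to^*_{\mathcal R/E}t_1$ and $t\to^*_{\mathcal R/E}t_2$ there are $t_1',t_2'$ with $t_i\to^*_{\mathcal R/E}t_i'$ and $t_1'=_Et_2'$. $\to_{\mathcal R}$ has the $\to_{\mathcal R,E}$-Church–Rosser property modulo $E$ if for all terms $t,t'$ related by the reflexive–transitive closure of $\leftrightarrow_E\cup\to_{\mathcal R}\cup\leftarrow_{\mathcal R}$ there are $u,u'$ with $t\to^*_{\mathcal R,E}u$, $t'\to^*_{\mathcal R,E}u'$, $u=_Eu'$. A conditional pair $\langle s,t\rangle\Leftarrow A_1,..,A_n$ is joinable modulo $E$ w.r.t. $\to_{\mathcal R,E}$ if for every substitution $\sigma$ with each $\sigma(A_i)$ deducible from $\mathsf{Th}^{CR}$ there are $u,u'$ with $\sigma(s)\to^*_{\mathcal R,E}u$, $\sigma(t)\to^*_{\mathcal R,E}u'$, $u=_Eu'$. LCCP of variable-disjoint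 rules $\alpha:s\to t\Leftarrow c$, $\alpha':u\to v\Leftarrow d$ at $p\in\mathcal{P}os^\mu_{\mathcal F}(s)$: $\langle s[v]_p,t\rangle\Leftarrow s|_p=u,c,d$; $\mathsf{LCCP}(\mathcal R)$: LCCPs with $\alpha,\alpha'\in R^{rm}$; $\mathsf{LCCP}(E,\mathcal R)$: LCCPs with $\alpha\in\overleftrightarrow E$, $\alpha'\in R^{rm}$. For a rule $s\to t\Leftarrow c$, $x\in\mathcal{V}ar^\mu(s)$, $p\in\mathcal{P}os^\mu_x(s)$, fresh $x'$, the CVP is $\langle s[x']_p,t\rangle\Leftarrow x\to_{ps}x',c$; $\mathsf{CVP}^{ps}(\mathcal R)$ / $\mathsf{CVP}^{ps}(E)$: these for rules of $R^{rm}$ / of $\overleftrightarrow E$.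
   Formalization: In R^rm and H^rm the symbol ≈ is replaced by ≈_rm only when ≈ depends on R; otherwise it is kept. Taken literally the claim fails if ≈ is independent of R and occurs in E: E={b=c⇐a≈a}, H={x≈x}, R={a→b, a→c, c→d}. *)

theory Defs
  imports Main "HOL-Library.Countable" "HOL-Library.Infinite_Typeclass"
begin

datatype ('f, 'v) trm = Var 'v | Fun 'f "('f, 'v) trm list"

primrec tvars :: "('f, 'v) trm \<Rightarrow> 'v set" where
  "tvars (Var x) = {x}"
| "tvars (Fun f ts) = \<Union> (set (map tvars ts))"

primrec subst :: "('v \<Rightarrow> ('f, 'w) trm) \<Rightarrow> ('f, 'v) trm \<Rightarrow> ('f, 'w) trm" where
  "subst \<sigma> (Var x) = \<sigma> x"
| "subst \<sigma> (Fun f ts) = Fun f (map (subst \<sigma>) ts)"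

text \<open>Positions are lists of argument indices, the root position being the empty list.
  Arguments are counted from 0, so that a replacement map takes values in subsets of
  \<open>{..<k}\<close> instead of \<open>{1..k}\<close>.\<close>

fun subt_at :: "('f, 'v) trm \<Rightarrow> nat list \<Rightarrow> ('f, 'v) trm" where
  "subt_at t [] = t"
| "subt_at (Fun f ts) (i # p) = subt_at (ts ! i) p"

fun replace_at :: "('f, 'v) trm \<Rightarrow> nat list \<Rightarrow> ('f, 'v) trm \<Rightarrow> ('f, 'v) trm" where
  "replace_at t [] s = s"
| "replace_at (Fun f ts) (i # p) s = Fun f (ts[i := replace_at (ts ! i) p s])"

function active_pos :: "('f \<Rightarrow> nat set) \<Rightarrow> ('f, 'v) trm \<Rightarrow> nat list set" where
  "active_pos \<mu> (Var x) = {[]}"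
| "active_pos \<mu> (Fun f ts) =
     {[]} \<union> (\<Union>i \<in> \<mu> f \<inter> {..<length ts}. (#) i ` active_pos \<mu> (ts ! i))"
  by pat_completeness auto
termination
  by (relation "measure (\<lambda>(\<mu>, t). size t)")
    (auto simp: less_Suc_eq_le intro: size_list_estimation'[OF nth_mem])

definition active_fun_pos :: "('f \<Rightarrow> nat set) \<Rightarrow> ('f, 'v) trm \<Rightarrow> nat list set" where
  "active_fun_pos \<mu> t = {p \<in> active_pos \<mu> t. \<exists>f ts. subt_at t p = Fun f ts}"

definition active_var_pos :: "('f \<Rightarrow> nat set) \<Rightarrow> 'v \<Rightarrow> ('f, 'v) trm \<Rightarrow> nat list set" where
  "active_var_pos \<mu> x t = {p \<in> active_pos \<mu> t. subt_at t p = Var x}"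

definition active_vars :: "('f \<Rightarrow> nat set) \<Rightarrow> ('f, 'v) trm \<Rightarrow> 'v set" where
  "active_vars \<mu> t = {x. active_var_pos \<mu> x t \<noteq> {}}"

text \<open>The predicates \<open>=\<close>, \<open>\<rightarrow>\<close>, \<open>\<rightarrow>\<^sup>*\<close>, \<open>\<approx>\<close> and the user predicates \<open>Usr P\<close> may occur in a system;
  the remaining ones are the new predicates of the associated theory.\<close>

datatype 'p psym =
    Eq | Rew | Rews | Approx | Usr 'p
  | RewPs | RewsPs | RewRm | RewsRm | ApproxRm

datatype ('p, 'f, 'v) atom = Atom (apred: "'p psym") (aargs: "('f, 'v) trm list")

abbreviation bin :: "'p psym \<Rightarrow> ('f, 'v) trm \<Rightarrow> ('f, 'v) trm \<Rightarrow> ('p, 'f, 'v) atom" where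
  "bin P s t \<equiv> Atom P [s, t]"

definition asubst :: "('v \<Rightarrow> ('f, 'w) trm) \<Rightarrow> ('p, 'f, 'v) atom \<Rightarrow> ('p, 'f, 'w) atom" where
  "asubst \<sigma> A = Atom (apred A) (map (subst \<sigma>) (aargs A))"

definition avars :: "('p, 'f, 'v) atom \<Rightarrow> 'v set" where
  "avars A = \<Union> (tvars ` set (aargs A))"

text \<open>A clause \<open>(A, [B\<^sub>1, \<dots>, B\<^sub>n])\<close> is the definite Horn clause \<open>A \<Leftarrow> B\<^sub>1, \<dots>, B\<^sub>n\<close>.
  A triple \<open>(s, t, c)\<close> is, depending on its use, the conditional equation \<open>s = t \<Leftarrow> c\<close>, the
  conditional rule \<open>s \<rightarrow> t \<Leftarrow> c\<close>, or the conditional pair \<open>\<langle>s, t\<rangle> \<Leftarrow> c\<close>.\<close>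

type_synonym ('p, 'f, 'v) clause = "('p, 'f, 'v) atom \<times> ('p, 'f, 'v) atom list"
type_synonym ('p, 'f, 'v) crule =
  "('f, 'v) trm \<times> ('f, 'v) trm \<times> ('p, 'f, 'v) atom list"

fun rule_vars :: "('p, 'f, 'v) crule \<Rightarrow> 'v set" where
  "rule_vars (s, t, c) = tvars s \<union> tvars t \<union> \<Union> (avars ` set c)"

fun rule_subst :: "('v \<Rightarrow> ('f, 'v) trm) \<Rightarrow> ('p, 'f, 'v) crule \<Rightarrow> ('p, 'f, 'v) crule" where
  "rule_subst \<sigma> (s, t, c) = (subst \<sigma> s, subst \<sigma> t, map (asubst \<sigma>) c)"

record ('p, 'f, 'v) egtrs =
  Fsig :: "'f set"
  far :: "'f \<Rightarrow> nat"
  Psig :: "'p set"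
  par :: "'p \<Rightarrow> nat"
  repl :: "'f \<Rightarrow> nat set"
  Eqs :: "('p, 'f, 'v) crule set"
  Hcl :: "('p, 'f, 'v) clause set"
  Rls :: "('p, 'f, 'v) crule set"

inductive_set terms :: "('p, 'f, 'v) egtrs \<Rightarrow> ('f, 'v) trm set" for \<R> where
  "Var x \<in> terms \<R>"
| "f \<in> Fsig \<R> \<Longrightarrow> length ts = far \<R> f \<Longrightarrow> \<forall>t \<in> set ts. t \<in> terms \<R> \<Longrightarrow> Fun f ts \<in> terms \<R>"

definition substs :: "('p, 'f, 'v) egtrs \<Rightarrow> ('v \<Rightarrow> ('f, 'v) trm) set" where
  "substs \<R> = {\<sigma>. \<forall>x. \<sigma> x \<in> terms \<R>}"

fun pred_arity :: "('p, 'f, 'v) egtrs \<Rightarrow> 'p psym \<Rightarrow> nat" where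
  "pred_arity \<R> (Usr P) = par \<R> P"
| "pred_arity \<R> _ = 2"

definition sig_preds :: "('p, 'f, 'v) egtrs \<Rightarrow> 'p psym set" where
  "sig_preds \<R> = {Eq, Rew, Rews, Approx} \<union> Usr ` Psig \<R>"

definition atoms :: "('p, 'f, 'v) egtrs \<Rightarrow> ('p, 'f, 'v) atom set" where
  "atoms \<R> = {A. apred A \<in> sig_preds \<R> \<and> length (aargs A) = pred_arity \<R> (apred A) \<and>
                 set (aargs A) \<subseteq> terms \<R>}"

inductive depends_on_R :: "('p, 'f, 'v) egtrs \<Rightarrow> 'p psym \<Rightarrow> bool" for \<R> where
  "depends_on_R \<R> Rew"
| "depends_on_R \<R> Rews"
| "(s, t, c) \<in> Eqs \<R> \<Longrightarrow> B \<in> set c \<Longrightarrow> depends_on_R \<R> (apred B) \<Longrightarrow> depends_on_R \<R> Eq"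
| "(A, c) \<in> Hcl \<R> \<Longrightarrow> B \<in> set c \<Longrightarrow> depends_on_R \<R> (apred B) \<Longrightarrow> depends_on_R \<R> (apred A)"

definition is_egtrs :: "('p, 'f, 'v) egtrs \<Rightarrow> bool" where
  "is_egtrs \<R> \<longleftrightarrow>
     (\<forall>f \<in> Fsig \<R>. repl \<R> f \<subseteq> {..<far \<R> f}) \<and>
     (\<forall>(s, t, c) \<in> Eqs \<R>. s \<in> terms \<R> \<and> t \<in> terms \<R> \<and> set c \<subseteq> atoms \<R>) \<and>
     (\<forall>(A, c) \<in> Hcl \<R>. A \<in> atoms \<R> \<and> set c \<subseteq> atoms \<R> \<and> apred A \<notin> {Eq, Rew, Rews}) \<and>
     (\<forall>(l, r, c) \<in> Rls \<R>. l \<in> terms \<R> \<and> r \<in> terms \<R> \<and> set c \<subseteq> atoms \<R> \<and> l \<notin> range Var) \<and>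
     \<not> depends_on_R \<R> Eq"

definition sym_rules :: "('p, 'f, 'v) egtrs \<Rightarrow> ('p, 'f, 'v) crule set" where
  "sym_rules \<R> = Eqs \<R> \<union> {(t, s, c) | s t c. (s, t, c) \<in> Eqs \<R>}"

text \<open>Replacing \<open>\<approx>\<close> by \<open>\<approx>\<^sub>r\<^sub>m\<close> in the rules and in the Horn clauses, but not in the equations, is
  meant for an \<open>\<approx>\<close> that is interpreted by rewriting, which then cannot occur in conditions
  of equations. If \<open>\<approx>\<close> does not depend on the rules, both symbols have the same meaning, and
  the replacement would only remove the clauses for an \<open>\<approx>\<close> occurring in equations (so that the
  equality of the theory below would no longer be the one generated by the equations);
  \<open>\<approx>\<close> is kept in this case.\<close>

fun rm_approx :: "('p, 'f, 'v) egtrs \<Rightarrow> 'p psym \<Rightarrow> 'p psym" where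
  "rm_approx \<R> Approx = (if depends_on_R \<R> Approx then ApproxRm else Approx)"
| "rm_approx \<R> P = P"

fun rm_all :: "('p, 'f, 'v) egtrs \<Rightarrow> 'p psym \<Rightarrow> 'p psym" where
  "rm_all \<R> Rew = RewRm"
| "rm_all \<R> Rews = RewsRm"
| "rm_all \<R> P = rm_approx \<R> P"

definition map_pred :: "('p psym \<Rightarrow> 'p psym) \<Rightarrow> ('p, 'f, 'v) atom \<Rightarrow> ('p, 'f, 'v) atom" where
  "map_pred h A = Atom (h (apred A)) (aargs A)"

definition Rls_rm :: "('p, 'f, 'v) egtrs \<Rightarrow> ('p, 'f, 'v) crule set" where
  "Rls_rm \<R> = {(l, r, map (map_pred (rm_approx \<R>)) c) | l r c. (l, r, c) \<in> Rls \<R>}"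

definition Hcl_rm :: "('p, 'f, 'v) egtrs \<Rightarrow> ('p, 'f, 'v) clause set" where
  "Hcl_rm \<R> = {(map_pred (rm_all \<R>) A, map (map_pred (rm_all \<R>)) c) | A c. (A, c) \<in> Hcl \<R>}"

text \<open>Clauses are read as their universal closures. An atom is deducible if it is obtained from
  instances of clauses by modus ponens; this is a sound and complete deduction procedure for
  definite Horn theories, see \<open>deducible_iff_consequence\<close> below.\<close>

inductive deducible ::
  "('p, 'f, 'v) egtrs \<Rightarrow> ('p, 'f, 'v) clause set \<Rightarrow> ('p, 'f, 'v) atom \<Rightarrow> bool"
  for \<R> Th where
  "(A, c) \<in> Th \<Longrightarrow> \<sigma> \<in> substs \<R> \<Longrightarrow> \<forall>B \<in> set c. deducible \<R> Th (asubst \<sigma> B)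
    \<Longrightarrow> deducible \<R> Th (asubst \<sigma> A)"

primrec eval :: "('f \<Rightarrow> 'd list \<Rightarrow> 'd) \<Rightarrow> ('v \<Rightarrow> 'd) \<Rightarrow> ('f, 'v) trm \<Rightarrow> 'd" where
  "eval I \<nu> (Var x) = \<nu> x"
| "eval I \<nu> (Fun f ts) = I f (map (eval I \<nu>) ts)"

definition holds ::
  "('f \<Rightarrow> 'd list \<Rightarrow> 'd) \<Rightarrow> ('p psym \<Rightarrow> 'd list \<Rightarrow> bool) \<Rightarrow> ('v \<Rightarrow> 'd) \<Rightarrow> ('p, 'f, 'v) atom \<Rightarrow> bool"
where
  "holds I J \<nu> A \<longleftrightarrow> J (apred A) (map (eval I \<nu>) (aargs A))"

definition is_structure ::
  "('p, 'f, 'v) egtrs \<Rightarrow> 'd set \<Rightarrow> ('f \<Rightarrow> 'd list \<Rightarrow> 'd) \<Rightarrow> bool" where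
  "is_structure \<R> D I \<longleftrightarrow> D \<noteq> {} \<and>
     (\<forall>f \<in> Fsig \<R>. \<forall>ds. length ds = far \<R> f \<and> set ds \<subseteq> D \<longrightarrow> I f ds \<in> D)"

definition is_model ::
  "('p, 'f, 'v) egtrs \<Rightarrow> ('p, 'f, 'v) clause set \<Rightarrow> 'd set \<Rightarrow> ('f \<Rightarrow> 'd list \<Rightarrow> 'd) \<Rightarrow>
   ('p psym \<Rightarrow> 'd list \<Rightarrow> bool) \<Rightarrow> bool" where
  "is_model \<R> Th D I J \<longleftrightarrow> is_structure \<R> D I \<and>
     (\<forall>(A, c) \<in> Th. \<forall>\<nu>. range \<nu> \<subseteq> D \<longrightarrow> (\<forall>B \<in> set c. holds I J \<nu> B) \<longrightarrow> holds I J \<nu> A)"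

lemma eval_subst: "eval I \<nu> (subst \<sigma> t) = eval I (\<lambda>x. eval I \<nu> (\<sigma> x)) t"
  by (induction t) (auto simp: comp_def cong: map_cong)

lemma eval_closed:
  assumes "t \<in> terms \<R>" "is_structure \<R> D I" "range \<nu> \<subseteq> D"
  shows "eval I \<nu> t \<in> D"
  using assms(1)
proof induction
  case (2 f ts)
  then have "set (map (eval I \<nu>) ts) \<subseteq> D" by auto
  with 2 assms(2) show ?case by (simp add: is_structure_def)
qed (use assms(3) in auto)

lemma holds_asubst: "holds I J \<nu> (asubst \<sigma> A) = holds I J (\<lambda>x. eval I \<nu> (\<sigma> x)) A"
  by (simp add: holds_def asubst_def comp_def eval_subst)

lemma deducible_sound:
  assumes "deducible \<R> Th A" "is_model \<R> Th D I J" "range \<nu> \<subseteq> D"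
  shows "holds I J \<nu> A"
  using assms(1)
proof induction
  case (1 A c \<sigma>)
  let ?\<nu> = "\<lambda>x. eval I \<nu> (\<sigma> x)"
  have "range ?\<nu> \<subseteq> D"
    using 1 assms by (auto simp: substs_def is_model_def intro: eval_closed)
  moreover have "\<forall>B \<in> set c. holds I J ?\<nu> B"
    using 1 by (simp add: holds_asubst)
  ultimately have "holds I J ?\<nu> A"
    using 1(1) assms(2) unfolding is_model_def by blast
  then show ?case by (simp add: holds_asubst)
qed

lemma eval_Fun: "eval Fun \<sigma> t = subst \<sigma> t"
  by (induction t) (auto cong: map_cong)

lemma subst_Var: "subst Var t = t"
  by (induction t) (auto simp: map_idI)

lemma deducible_iff_consequence:
  fixes \<R> :: "('p, 'f, 'v) egtrs"
  shows "deducible \<R> Th A \<longleftrightarrow>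
    (\<forall>(D :: ('f, 'v) trm set) I J \<nu>. is_model \<R> Th D I J \<and> range \<nu> \<subseteq> D \<longrightarrow> holds I J \<nu> A)"
    (is "_ \<longleftrightarrow> ?cons")
proof
  show "deducible \<R> Th A \<Longrightarrow> ?cons" by (blast intro: deducible_sound)
next
  assume cons: ?cons
  define J where "J = (\<lambda>P ts. deducible \<R> Th (Atom P ts))"
  have holds: "holds Fun J \<sigma> B \<longleftrightarrow> deducible \<R> Th (asubst \<sigma> B)"
    for \<sigma> :: "'v \<Rightarrow> ('f, 'v) trm" and B
    by (simp add: holds_def J_def asubst_def eval_Fun[abs_def])
  have "is_structure \<R> (terms \<R>) Fun"
    by (auto simp: is_structure_def intro: terms.intros)
  then have "is_model \<R> Th (terms \<R>) Fun J"
    unfolding is_model_def holds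
    by (auto simp: substs_def image_subset_iff simp del: subst.simps intro: deducible.intros)
  moreover have "range Var \<subseteq> terms \<R>" by (auto intro: terms.intros)
  ultimately have "holds Fun J Var A" using cons by blast
  then show "deducible \<R> Th A"
    by (simp add: holds asubst_def subst_Var[abs_def])
qed

definition refl_ax :: "'p psym \<Rightarrow> ('p, 'f, 'v) clause set" where
  "refl_ax P = {(bin P (Var x) (Var x), []) | x. True}"

definition sym_ax :: "'p psym \<Rightarrow> ('p, 'f, 'v) clause set" where
  "sym_ax P = {(bin P (Var y) (Var x), [bin P (Var x) (Var y)]) | x y. x \<noteq> y}"

text \<open>\<open>x P y \<and> y Q z \<Longrightarrow> x Q z\<close>\<close>

definition trans_ax :: "'p psym \<Rightarrow> 'p psym \<Rightarrow> ('p, 'f, 'v) clause set" where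
  "trans_ax P Q =
     {(bin Q (Var x) (Var z), [bin P (Var x) (Var y), bin Q (Var y) (Var z)]) | x y z.
        distinct [x, y, z]}"

definition prop_ax :: "('p, 'f, 'v) egtrs \<Rightarrow> 'p psym \<Rightarrow> ('p, 'f, 'v) clause set" where
  "prop_ax \<R> P =
     {(bin P (Fun f (map Var xs)) (Fun f (map Var (xs[i := y]))), [bin P (Var (xs ! i)) (Var y)])
      | f i xs y. f \<in> Fsig \<R> \<and> i \<in> repl \<R> f \<and> length xs = far \<R> f \<and> distinct (y # xs)}"

definition rule_ax :: "'p psym \<Rightarrow> ('p, 'f, 'v) crule set \<Rightarrow> ('p, 'f, 'v) clause set" where
  "rule_ax P rs = {(bin P l r, c) | l r c. (l, r, c) \<in> rs}"

definition modulo_rule_ax :: "'p psym \<Rightarrow> ('p, 'f, 'v) crule set \<Rightarrow> ('p, 'f, 'v) clause set" where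
  "modulo_rule_ax P rs =
     {(bin P (Var x) r, bin Eq (Var x) l # c) | x l r c.
        (l, r, c) \<in> rs \<and> x \<notin> rule_vars (l, r, c)}"

definition eq_ax :: "('p, 'f, 'v) egtrs \<Rightarrow> ('p, 'f, 'v) clause set" where
  "eq_ax \<R> = refl_ax Eq \<union> sym_ax Eq \<union> trans_ax Eq Eq \<union> prop_ax \<R> Eq \<union> rule_ax Eq (Eqs \<R>)"

definition rew_ax ::
  "('p, 'f, 'v) egtrs \<Rightarrow> ('p, 'f, 'v) crule set \<Rightarrow> ('p, 'f, 'v) clause set" where
  "rew_ax \<R> rs = refl_ax Rews \<union> trans_ax Rew Rews \<union> prop_ax \<R> Rew \<union> rule_ax Rew rs"

definition ps_ax :: "('p, 'f, 'v) egtrs \<Rightarrow> ('p, 'f, 'v) clause set" where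
  "ps_ax \<R> =
     refl_ax RewsPs \<union> trans_ax RewPs RewsPs \<union> prop_ax \<R> RewPs \<union> modulo_rule_ax RewPs (Rls_rm \<R>)"

definition rm_ax :: "('p, 'f, 'v) clause set" where
  "rm_ax = refl_ax RewsRm \<union> trans_ax RewRm RewsRm \<union>
     {(bin RewRm (Var x) (Var y),
       [bin Eq (Var x) (Var x'), bin Rew (Var x') (Var y'), bin Eq (Var y') (Var y)])
      | x x' y' y. distinct [x, x', y', y]}"

definition Th_CR :: "('p, 'f, 'v) egtrs \<Rightarrow> ('p, 'f, 'v) clause set" where
  "Th_CR \<R> = eq_ax \<R> \<union> rew_ax \<R> (Rls_rm \<R>) \<union> ps_ax \<R> \<union> rm_ax \<union> Hcl_rm \<R>"

definition step_R :: "('p, 'f, 'v) egtrs \<Rightarrow> ('f, 'v) trm \<Rightarrow> ('f, 'v) trm \<Rightarrow> bool" where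
  "step_R \<R> s t \<longleftrightarrow> deducible \<R> (Th_CR \<R>) (bin Rew s t)"

definition step_RE :: "('p, 'f, 'v) egtrs \<Rightarrow> ('f, 'v) trm \<Rightarrow> ('f, 'v) trm \<Rightarrow> bool" where
  "step_RE \<R> s t \<longleftrightarrow> deducible \<R> (Th_CR \<R>) (bin RewPs s t)"

definition step_RmodE :: "('p, 'f, 'v) egtrs \<Rightarrow> ('f, 'v) trm \<Rightarrow> ('f, 'v) trm \<Rightarrow> bool" where
  "step_RmodE \<R> s t \<longleftrightarrow> deducible \<R> (Th_CR \<R>) (bin RewRm s t)"

definition eq_E :: "('p, 'f, 'v) egtrs \<Rightarrow> ('f, 'v) trm \<Rightarrow> ('f, 'v) trm \<Rightarrow> bool" where
  "eq_E \<R> s t \<longleftrightarrow> deducible \<R> (eq_ax \<R> \<union> Hcl \<R>) (bin Eq s t)"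

definition step_E :: "('p, 'f, 'v) egtrs \<Rightarrow> ('f, 'v) trm \<Rightarrow> ('f, 'v) trm \<Rightarrow> bool" where
  "step_E \<R> s t \<longleftrightarrow> deducible \<R> (rew_ax \<R> (sym_rules \<R>)) (bin Rew s t)"

definition E_terminating :: "('p, 'f, 'v) egtrs \<Rightarrow> bool" where
  "E_terminating \<R> \<longleftrightarrow> \<not> (\<exists>t. \<forall>i::nat. step_RmodE \<R> (t i) (t (Suc i)))"

definition E_confluent :: "('p, 'f, 'v) egtrs \<Rightarrow> bool" where
  "E_confluent \<R> \<longleftrightarrow>
     (\<forall>t \<in> terms \<R>. \<forall>t1 t2. (step_RmodE \<R>)\<^sup>*\<^sup>* t t1 \<and> (step_RmodE \<R>)\<^sup>*\<^sup>* t t2 \<longrightarrow>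
        (\<exists>t1' t2'. (step_RmodE \<R>)\<^sup>*\<^sup>* t1 t1' \<and> (step_RmodE \<R>)\<^sup>*\<^sup>* t2 t2' \<and> eq_E \<R> t1' t2'))"

definition RE_joinable :: "('p, 'f, 'v) egtrs \<Rightarrow> ('f, 'v) trm \<Rightarrow> ('f, 'v) trm \<Rightarrow> bool" where
  "RE_joinable \<R> s t \<longleftrightarrow>
     (\<exists>u u'. (step_RE \<R>)\<^sup>*\<^sup>* s u \<and> (step_RE \<R>)\<^sup>*\<^sup>* t u' \<and> eq_E \<R> u u')"

definition church_rosser_mod_E :: "('p, 'f, 'v) egtrs \<Rightarrow> bool" where
  "church_rosser_mod_E \<R> \<longleftrightarrow>
     (\<forall>t \<in> terms \<R>. \<forall>t' \<in> terms \<R>.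
        (sup (step_E \<R>) (sup (step_R \<R>) (step_R \<R>)\<inverse>\<inverse>))\<^sup>*\<^sup>* t t' \<longrightarrow> RE_joinable \<R> t t')"

fun pair_joinable :: "('p, 'f, 'v) egtrs \<Rightarrow> ('p, 'f, 'v) crule \<Rightarrow> bool" where
  "pair_joinable \<R> (s, t, c) \<longleftrightarrow>
     (\<forall>\<sigma> \<in> substs \<R>. (\<forall>A \<in> set c. deducible \<R> (Th_CR \<R>) (asubst \<sigma> A)) \<longrightarrow>
        RE_joinable \<R> (subst \<sigma> s) (subst \<sigma> t))"

definition variants :: "('p, 'f, 'v) crule set \<Rightarrow> ('p, 'f, 'v) crule set" where
  "variants rs = {rule_subst (Var \<circ> \<pi>) \<alpha> | \<pi> \<alpha>. bij \<pi> \<and> \<alpha> \<in> rs}"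

text \<open>The second rule is taken up to renaming, so that variable-disjointness can be achieved for
  any two rules, in particular for two copies of the same rule.\<close>

definition lccps ::
  "('p, 'f, 'v) egtrs \<Rightarrow> ('p, 'f, 'v) crule set \<Rightarrow> ('p, 'f, 'v) crule set \<Rightarrow> ('p, 'f, 'v) crule set"
where
  "lccps \<R> rs rs' =
     {(replace_at s p v, t, bin Eq (subt_at s p) u # c @ d) | s t c u v d p.
        (s, t, c) \<in> rs \<and> (u, v, d) \<in> variants rs' \<and>
        rule_vars (s, t, c) \<inter> rule_vars (u, v, d) = {} \<and>
        p \<in> active_fun_pos (repl \<R>) s}"

definition cvps_ps ::
  "('p, 'f, 'v) egtrs \<Rightarrow> ('p, 'f, 'v) crule set \<Rightarrow> ('p, 'f, 'v) crule set" where
  "cvps_ps \<R> rs =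
     {(replace_at s p (Var x'), t, bin RewPs (Var x) (Var x') # c) | s t c x x' p.
        (s, t, c) \<in> rs \<and> x \<in> active_vars (repl \<R>) s \<and> p \<in> active_var_pos (repl \<R>) x s \<and>
        x' \<notin> rule_vars (s, t, c)}"

definition LCCP_R :: "('p, 'f, 'v) egtrs \<Rightarrow> ('p, 'f, 'v) crule set" where
  "LCCP_R \<R> = lccps \<R> (Rls_rm \<R>) (Rls_rm \<R>)"

definition LCCP_E_R :: "('p, 'f, 'v) egtrs \<Rightarrow> ('p, 'f, 'v) crule set" where
  "LCCP_E_R \<R> = lccps \<R> (sym_rules \<R>) (Rls_rm \<R>)"

definition CVP_ps_R :: "('p, 'f, 'v) egtrs \<Rightarrow> ('p, 'f, 'v) crule set" where
  "CVP_ps_R \<R> = cvps_ps \<R> (Rls_rm \<R>)"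

definition CVP_ps_E :: "('p, 'f, 'v) egtrs \<Rightarrow> ('p, 'f, 'v) crule set" where
  "CVP_ps_E \<R> = cvps_ps \<R> (sym_rules \<R>)"

end

theory Submission
  imports Defs "HOL-Combinatorics.Transposition"
begin

text \<open>
  An instance \<open>\<sigma>(l)\<close> of the left-hand side of a rule or an equation, rewritten modulo \<open>E\<close> at any
  active position, gives an instance of an LCCP or of a CVP, which is joinable by assumption. The
  remaining peak has a step modulo \<open>E\<close> at the root, \<open>s =\<^sub>E \<sigma>(l) \<rightarrow> \<sigma>(r)\<close>, against a step \<open>s \<rightarrow> e\<close>
  strictly below, which need not overlap with \<open>l\<close>. It is handled by transporting \<open>s \<rightarrow> e\<close> along the
  equational chain from \<open>s\<close> to \<open>\<sigma>(l)\<close>: the peak of an equational step \<open>s \<leftrightarrow> t\<close> and a step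
  \<open>s \<rightarrow> e\<close> is joinable, and joining it has to rewrite \<open>t\<close>, since otherwise \<open>e\<close> would lead back
  to \<open>s\<close> modulo \<open>E\<close>, contradicting termination. The intermediate joins are glued by well-founded
  induction on rewriting modulo \<open>E\<close> combined with passing to active arguments, which is still
  terminating because rewriting is closed under active contexts.
\<close>

section \<open>Rewriting modulo a partial equivalence\<close>

lemma wf_Un_if_quasi_commute:
  assumes "wf R" "wf S" "R O S \<subseteq> (R \<union> S)\<^sup>* O R"
  shows "wf (R \<union> S)"
proof -
  let ?R = "S\<^sup>* O R O S\<^sup>*"
  have "wf ?R" using qc_wf_relto_iff[OF assms(3)] assms(1) by simp
  moreover have "?R O S \<subseteq> ?R" by (auto intro: rtrancl_into_rtrancl)
  ultimately have "wf (?R \<union> S)" using assms(2) by (blast intro: wf_union_compatible)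
  then show ?thesis by (rule wf_subset) auto
qed

text \<open>The carrier of the system is the field of \<open>\<approx>\<close>, that is, the set of all \<open>s\<close> with \<open>s \<approx> s\<close>.\<close>

locale rewriting_modulo =
  fixes eqv :: "'a \<Rightarrow> 'a \<Rightarrow> bool" (infix "\<approx>" 50)
    and step :: "'a \<Rightarrow> 'a \<Rightarrow> bool" (infix "\<leadsto>" 50)
  assumes eqv_sym: "s \<approx> t \<Longrightarrow> t \<approx> s"
    and eqv_trans: "s \<approx> t \<Longrightarrow> t \<approx> u \<Longrightarrow> s \<approx> u"
    and step_carrier: "s \<leadsto> t \<Longrightarrow> s \<approx> s \<and> t \<approx> t"
begin

abbreviation steps (infix "\<leadsto>\<^sup>*" 50) where "steps \<equiv> step\<^sup>*\<^sup>*"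

abbreviation reaches where "reaches \<equiv> (sup step eqv)\<^sup>*\<^sup>*"

definition step_mod :: "'a \<Rightarrow> 'a \<Rightarrow> bool" where
  "step_mod s t \<longleftrightarrow> (\<exists>s' t'. s \<approx> s' \<and> s' \<leadsto> t' \<and> t' \<approx> t)"

definition joinable :: "'a \<Rightarrow> 'a \<Rightarrow> bool" (infix "\<down>" 50) where
  "s \<down> t \<longleftrightarrow> (\<exists>u u'. s \<leadsto>\<^sup>* u \<and> t \<leadsto>\<^sup>* u' \<and> u \<approx> u')"

definition confluent_at :: "'a \<Rightarrow> bool" where
  "confluent_at w \<longleftrightarrow> (\<forall>a b. reaches w a \<longrightarrow> reaches w b \<longrightarrow> a \<down> b)"

definition reducts_confluent :: "'a \<Rightarrow> bool" where
  "reducts_confluent w \<longleftrightarrow> (\<forall>d. step_mod w d \<longrightarrow> confluent_at d)"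

lemma eqv_refl: "s \<approx> t \<Longrightarrow> s \<approx> s \<and> t \<approx> t"
  using eqv_sym eqv_trans by blast

lemma step_imp_step_mod: "s \<leadsto> t \<Longrightarrow> step_mod s t"
  using step_carrier unfolding step_mod_def by blast

lemma eqv_step_mod: "s \<approx> s' \<Longrightarrow> step_mod s' t \<Longrightarrow> step_mod s t"
  unfolding step_mod_def using eqv_trans by blast

lemma step_imp_reaches: "s \<leadsto> t \<Longrightarrow> reaches s t"
  by blast

lemma eqv_imp_reaches: "s \<approx> t \<Longrightarrow> reaches s t"
  by blast

lemma steps_imp_reaches: "s \<leadsto>\<^sup>* t \<Longrightarrow> reaches s t"
  by (erule rtranclp_mono[THEN predicate2D, rotated]) auto

lemma step_mod_imp_reaches: "step_mod s t \<Longrightarrow> reaches s t"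
  unfolding step_mod_def by (meson eqv_imp_reaches rtranclp_trans step_imp_reaches)

lemma eqv_imp_joinable: "s \<approx> t \<Longrightarrow> s \<down> t"
  unfolding joinable_def by blast

lemma joinable_sym: "s \<down> t \<Longrightarrow> t \<down> s"
  unfolding joinable_def using eqv_sym by blast

lemma steps_joinable: "s \<leadsto>\<^sup>* s' \<Longrightarrow> t \<leadsto>\<^sup>* t' \<Longrightarrow> s' \<down> t' \<Longrightarrow> s \<down> t"
  unfolding joinable_def by (meson rtranclp_trans)

lemma step_imp_joinable: "s \<leadsto> t \<Longrightarrow> s \<down> t"
  using steps_joinable[of s t t t] eqv_imp_joinable step_carrier by blast

lemma joinable_imp_reaches:
  assumes "s \<down> t"
  shows "\<exists>u. s \<leadsto>\<^sup>* u \<and> reaches t u"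
proof -
  obtain u u' where u: "s \<leadsto>\<^sup>* u" "t \<leadsto>\<^sup>* u'" "u \<approx> u'"
    using assms joinable_def by blast
  have "reaches t u"
    using steps_imp_reaches[OF u(2)] eqv_imp_reaches[OF eqv_sym[OF u(3)]] by (rule rtranclp_trans)
  then show ?thesis using u(1) by blast
qed

lemma confluent_atD: "confluent_at w \<Longrightarrow> reaches w a \<Longrightarrow> reaches w b \<Longrightarrow> a \<down> b"
  unfolding confluent_at_def by blast

lemma joinable_trans:
  assumes "confluent_at b" "a \<down> b" "b \<down> c"
  shows "a \<down> c"
proof -
  obtain x where x: "a \<leadsto>\<^sup>* x" "reaches b x"
    using joinable_imp_reaches[OF assms(2)] by blast
  obtain y where y: "c \<leadsto>\<^sup>* y" "reaches b y"
    using joinable_imp_reaches[OF joinable_sym[OF assms(3)]] by blast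
  show ?thesis
    using x(1) y(1) confluent_atD[OF assms(1) x(2) y(2)] by (rule steps_joinable)
qed

lemma reducts_confluent_eqv: "reducts_confluent s \<Longrightarrow> s \<approx> t \<Longrightarrow> reducts_confluent t"
  unfolding reducts_confluent_def using eqv_step_mod by blast

lemma reducts_confluentD: "reducts_confluent s \<Longrightarrow> s \<leadsto> d \<Longrightarrow> confluent_at d"
  unfolding reducts_confluent_def using step_imp_step_mod by blast

lemma reaches_first_step:
  assumes "reaches s t" "s \<approx> s"
  shows "s \<approx> t \<or> (\<exists>s' d. s \<approx> s' \<and> s' \<leadsto> d \<and> reaches d t)"
  using assms
proof (induction rule: converse_rtranclp_induct)
  case (step y z)
  from step(1) show ?case
  proof
    assume "y \<leadsto> z"
    then show ?case using step(2,4) by blast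
  next
    assume "y \<approx> z"
    then show ?case using step(3) eqv_refl eqv_trans by blast
  qed
qed simp

lemma step_mod_irreversible:
  assumes "wfp step_mod\<inverse>\<inverse>" "step_mod s d"
  shows "\<not> reaches d s"
  using assms
proof (induction s arbitrary: d rule: wfp_induct_rule)
  case (less s)
  show ?case
  proof
    assume ds: "reaches d s"
    have sd: "reaches s d" using step_mod_imp_reaches[OF less(2)] .
    have "d \<approx> d" using less(2) eqv_refl unfolding step_mod_def by blast
    from reaches_first_step[OF ds this] show False
    proof (elim disjE exE conjE)
      assume "d \<approx> s"
      then have "step_mod d d" using less(2) eqv_step_mod by blast
      then show False using less by blast
    next
      fix d' e assume "d \<approx> d'" "d' \<leadsto> e" "reaches e s"
      then have "step_mod d e" "reaches e d"
        using sd eqv_step_mod step_imp_step_mod by (blast intro: rtranclp_trans)+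
      then show False using less by blast
    qed
  qed
qed

lemma church_rosser_if_confluent:
  assumes "\<And>w. w \<approx> w \<Longrightarrow> confluent_at w" "s \<approx> s" "(sup eqv (sup step step\<inverse>\<inverse>))\<^sup>*\<^sup>* s t"
  shows "s \<down> t"
  using assms(3)
proof (induction rule: rtranclp_induct)
  case base
  show ?case using assms(2) by (rule eqv_imp_joinable)
next
  case (step t u)
  have "t \<down> u"
    using step(2) eqv_imp_joinable step_imp_joinable joinable_sym by blast
  moreover have "t \<approx> t" using step(2) eqv_refl step_carrier by blast
  ultimately show ?case using joinable_trans step(3) assms(1) by blast
qed

end

locale locally_coherent = rewriting_modulo +
  fixes eqv_step :: "'a \<Rightarrow> 'a \<Rightarrow> bool" (infix "\<turnstile>" 50)
  assumes terminating: "wfp step_mod\<inverse>\<inverse>"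
    and eqv_step_imp_eqv: "s \<turnstile> t \<Longrightarrow> s \<approx> t"
    and eqv_imp_eqv_steps: "s \<approx> t \<Longrightarrow> eqv_step\<^sup>*\<^sup>* s t"
    and eqv_step_peak: "s \<turnstile> t \<Longrightarrow> s \<leadsto> d \<Longrightarrow> d \<down> t"
begin

text \<open>If joining \<open>d\<close> and \<open>t\<close> required no rewriting of \<open>t\<close>, then \<open>s\<close> would be reachable from its
  own reduct \<open>d\<close>, contradicting termination.\<close>

lemma local_coherence:
  assumes "s \<turnstile> t" "s \<leadsto> d"
  shows "\<exists>e. t \<leadsto> e \<and> d \<down> e"
proof -
  obtain u u' where u: "d \<leadsto>\<^sup>* u" "t \<leadsto>\<^sup>* u'" "u \<approx> u'"
    using eqv_step_peak[OF assms] joinable_def by blast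
  have "t \<approx> s" using eqv_sym[OF eqv_step_imp_eqv[OF assms(1)]] .
  then have "step_mod t d" using eqv_step_mod step_imp_step_mod[OF assms(2)] by blast
  then have "\<not> reaches d t" using step_mod_irreversible[OF terminating] by blast
  moreover have "reaches d u'"
    using steps_imp_reaches[OF u(1)] eqv_imp_reaches[OF u(3)] by (rule rtranclp_trans)
  ultimately have "t \<noteq> u'" by blast
  with u(2) obtain e where "t \<leadsto> e" "e \<leadsto>\<^sup>* u'"
    by (cases rule: converse_rtranclpE) auto
  then show ?thesis using u(1,3) joinable_def by blast
qed

lemma coherence:
  assumes "reducts_confluent s" "s \<approx> t" "s \<leadsto> d"
  shows "\<exists>e. t \<leadsto> e \<and> d \<down> e"
  using eqv_imp_eqv_steps[OF assms(2)]
proof (induction rule: rtranclp_induct)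
  case base
  show ?case using assms(3) step_carrier eqv_imp_joinable by blast
next
  case (step y z)
  then obtain e where e: "y \<leadsto> e" "d \<down> e" by blast
  obtain e' where e': "z \<leadsto> e'" "e \<down> e'" using local_coherence[OF step(2) e(1)] by blast
  have "s \<approx> y" using step(1)
  proof (induction rule: rtranclp_induct)
    case base
    show ?case using eqv_refl[OF assms(2)] by blast
  next
    case (step u v)
    show ?case using step(3) eqv_step_imp_eqv[OF step(2)] by (rule eqv_trans)
  qed
  then have "confluent_at e"
    using reducts_confluentD[OF reducts_confluent_eqv[OF assms(1)] e(1)] by blast
  then show ?case using joinable_trans e(2) e' by blast
qed

lemma reaches_joinable_reduct:
  assumes "reducts_confluent w" "reaches w a" "w \<approx> w"
  shows "w \<approx> a \<or> (\<exists>d. w \<leadsto> d \<and> d \<down> a)"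
  using reaches_first_step[OF assms(2,3)]
proof (elim disjE exE conjE)
  fix s d assume d: "w \<approx> s" "s \<leadsto> d" "reaches d a"
  note s = reducts_confluent_eqv[OF assms(1) d(1)]
  obtain e where e: "w \<leadsto> e" "d \<down> e" using coherence[OF s eqv_sym[OF d(1)] d(2)] by blast
  have "confluent_at d" using reducts_confluentD[OF s d(2)] .
  then have "e \<down> a" using confluent_atD d(3) joinable_trans joinable_sym[OF e(2)] by blast
  then show ?thesis using e(1) by blast
qed simp

lemma confluent_at_if_reducts_confluent:
  assumes below: "reducts_confluent w" and w: "w \<approx> w"
    and local_confluence: "\<And>d e. w \<leadsto> d \<Longrightarrow> w \<leadsto> e \<Longrightarrow> d \<down> e"
  shows "confluent_at w"
  unfolding confluent_at_def
proof (intro allI impI)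
  fix a b assume a: "reaches w a" and b: "reaches w b"
  have glue: "u \<down> v" if "w \<leadsto> d" "u \<down> d" "d \<down> v" for d u v
    using joinable_trans[OF reducts_confluentD[OF below that(1)] that(2,3)] .
  have mixed: "u \<down> v" if u: "w \<approx> u" and d: "w \<leadsto> d" "d \<down> v" for u v d
  proof -
    obtain e where e: "u \<leadsto> e" "d \<down> e" using coherence[OF below u d(1)] by blast
    have "e \<down> v" using glue[OF d(1) joinable_sym[OF e(2)] d(2)] .
    then show ?thesis using steps_joinable e(1) by blast
  qed
  from reaches_joinable_reduct[OF below a w] reaches_joinable_reduct[OF below b w]
  show "a \<down> b"
  proof (elim disjE exE conjE)
    assume "w \<approx> a" "w \<approx> b"
    then show ?thesis using eqv_imp_joinable eqv_sym eqv_trans by blast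
  next
    fix d assume "w \<approx> a" "w \<leadsto> d" "d \<down> b"
    then show ?thesis by (rule mixed)
  next
    fix d assume "w \<leadsto> d" "d \<down> a" "w \<approx> b"
    then show ?thesis using mixed joinable_sym by blast
  next
    fix d e assume d: "w \<leadsto> d" "d \<down> a" and e: "w \<leadsto> e" "e \<down> b"
    have "a \<down> e" using glue[OF d(1) joinable_sym[OF d(2)] local_confluence[OF d(1) e(1)]] .
    then show ?thesis using glue[OF e(1)] e(2) by blast
  qed
qed

end

section \<open>Substitutions and renamings\<close>

lemma ex_renaming_apart:
  assumes "finite B" "finite (A :: 'v :: infinite set)"
  shows "\<exists>\<pi> :: 'v \<Rightarrow> 'v. bij \<pi> \<and> \<pi> ` B \<inter> A = {}"
  using assms(1)
proof (induction B)
  case empty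
  show ?case using bij_id by blast
next
  case (insert b B)
  then obtain \<pi> :: "'v \<Rightarrow> 'v" where \<pi>: "bij \<pi>" "\<pi> ` B \<inter> A = {}" by blast
  obtain z where z: "z \<notin> A \<union> \<pi> ` insert b B"
    using ex_new_if_finite[OF infinite_UNIV, of "A \<union> \<pi> ` insert b B"] insert(1) assms(2) by blast
  let ?\<pi> = "Transposition.transpose (\<pi> b) z \<circ> \<pi>"
  have "?\<pi> x = \<pi> x" if "x \<in> B" for x
    using that z insert(2) bij_is_inj[OF \<pi>(1)] by (auto simp: inj_eq Transposition.transpose_def)
  then have "?\<pi> ` insert b B \<inter> A = {}" using \<pi>(2) z by auto
  moreover have "bij ?\<pi>" using \<pi>(1) by (simp add: bij_comp)
  ultimately show ?case by blast
qed

lemma obtain_vars_subst: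
  fixes ts :: "('f, 'v :: infinite) trm list"
  assumes "set ts \<subseteq> terms \<R>"
  obtains xs \<sigma> where "distinct xs" "\<sigma> \<in> substs \<R>" "map \<sigma> xs = ts"
  using assms
proof (induction ts arbitrary: thesis)
  case Nil
  show ?case by (rule Nil.prems(1)[of "[]" Var]) (simp_all add: substs_def terms.intros(1))
next
  case (Cons t ts)
  obtain xs :: "'v list" and \<sigma> where ts: "distinct xs" "\<sigma> \<in> substs \<R>" "map \<sigma> xs = ts"
    using Cons.IH Cons.prems(2) by auto
  obtain x where x: "x \<notin> set xs" using ex_new_if_finite[OF infinite_UNIV finite_set] by blast
  show ?case
    by (rule Cons.prems(1)[of "x # xs" "\<sigma>(x := t)"])
      (use ts x Cons.prems(2) in \<open>auto simp: substs_def\<close>)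
qed

lemma subst_cong: "(\<And>x. x \<in> tvars t \<Longrightarrow> \<sigma> x = \<tau> x) \<Longrightarrow> subst \<sigma> t = subst \<tau> t"
  by (induction t) auto

lemma subst_subst: "subst \<sigma> (subst \<tau> t) = subst (\<lambda>x. subst \<sigma> (\<tau> x)) t"
  by (induction t) auto

lemma subst_in_terms: "t \<in> terms \<R> \<Longrightarrow> \<sigma> \<in> substs \<R> \<Longrightarrow> subst \<sigma> t \<in> terms \<R>"
  by (induction t rule: terms.induct) (auto simp: substs_def intro!: terms.intros)

lemma Fun_in_terms_iff:
  "Fun f ts \<in> terms \<R> \<longleftrightarrow> f \<in> Fsig \<R> \<and> length ts = far \<R> f \<and> set ts \<subseteq> terms \<R>"
  by (auto elim: terms.cases intro: terms.intros)

lemma update_in_terms: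
  "Fun f ts \<in> terms \<R> \<Longrightarrow> t \<in> terms \<R> \<Longrightarrow> Fun f (ts[i := t]) \<in> terms \<R>"
  by (auto simp: Fun_in_terms_iff dest!: set_update_subset_insert[THEN subsetD])

lemma asubst_bin: "asubst \<sigma> (bin P s t) = bin P (subst \<sigma> s) (subst \<sigma> t)"
  by (simp add: asubst_def)

lemma apred_asubst: "apred (asubst \<sigma> A) = apred A"
  by (simp add: asubst_def)

lemma asubst_cong: "(\<And>x. x \<in> avars A \<Longrightarrow> \<sigma> x = \<tau> x) \<Longrightarrow> asubst \<sigma> A = asubst \<tau> A"
  by (auto simp: asubst_def avars_def intro!: subst_cong)

lemma asubst_asubst: "asubst \<sigma> (asubst \<tau> A) = asubst (\<lambda>x. subst \<sigma> (\<tau> x)) A"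
  by (simp add: asubst_def subst_subst)

lemma rule_subst_cong:
  "(\<And>x. x \<in> rule_vars \<alpha> \<Longrightarrow> \<sigma> x = \<tau> x) \<Longrightarrow> rule_subst \<sigma> \<alpha> = rule_subst \<tau> \<alpha>"
  by (cases \<alpha>) (auto intro!: subst_cong asubst_cong)

lemma rule_subst_rule_subst:
  "rule_subst \<sigma> (rule_subst \<tau> \<alpha>) = rule_subst (\<lambda>x. subst \<sigma> (\<tau> x)) \<alpha>"
  by (cases \<alpha>) (auto simp: subst_subst asubst_asubst)

lemma finite_tvars: "finite (tvars t)"
  by (induction t) auto

lemma finite_rule_vars: "finite (rule_vars \<alpha>)"
  by (cases \<alpha>) (auto simp: finite_tvars avars_def)

lemma tvars_renaming: "tvars (subst (Var \<circ> \<pi>) t) = \<pi> ` tvars t"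
  by (induction t) auto

lemma rule_vars_renaming: "rule_vars (rule_subst (Var \<circ> \<pi>) \<alpha>) = \<pi> ` rule_vars \<alpha>"
  by (cases \<alpha>) (auto simp: tvars_renaming avars_def asubst_def image_Un image_UN)

lemma ex_variant_apart:
  fixes \<alpha> :: "('p, 'f, 'v :: infinite) crule"
  assumes "\<alpha> \<in> rs" "finite V"
  shows "\<exists>\<beta> \<in> variants rs. V \<inter> rule_vars \<beta> = {} \<and>
    (\<forall>\<sigma> \<in> substs \<R>. \<exists>\<tau> \<in> substs \<R>. rule_subst \<tau> \<beta> = rule_subst \<sigma> \<alpha>)"
proof -
  obtain \<pi> :: "'v \<Rightarrow> 'v" where \<pi>: "bij \<pi>" "\<pi> ` rule_vars \<alpha> \<inter> V = {}"
    using ex_renaming_apart[OF finite_rule_vars assms(2)] by blast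
  let ?\<beta> = "rule_subst (Var \<circ> \<pi>) \<alpha>"
  have "rule_subst (\<sigma> \<circ> inv \<pi>) ?\<beta> = rule_subst \<sigma> \<alpha>" for \<sigma> :: "'v \<Rightarrow> ('f, 'v) trm"
    using \<pi>(1) by (simp add: rule_subst_rule_subst bij_is_inj)
  moreover have "\<sigma> \<circ> inv \<pi> \<in> substs \<R>" if "\<sigma> \<in> substs \<R>" for \<sigma>
    using that by (simp add: substs_def)
  moreover have "?\<beta> \<in> variants rs" unfolding variants_def
    by (intro CollectI exI[of _ \<pi>] exI[of _ \<alpha>] conjI refl assms(1) \<pi>(1))
  moreover have "V \<inter> rule_vars ?\<beta> = {}"
    using \<pi>(2) by (simp only: rule_vars_renaming Int_commute)
  ultimately show ?thesis by meson
qed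

lemma tvars_subt_at: "p \<in> active_pos \<mu> t \<Longrightarrow> tvars (subt_at t p) \<subseteq> tvars t"
  by (induction t p rule: subt_at.induct) fastforce+

lemma subst_replace_at:
  "p \<in> active_pos \<mu> t \<Longrightarrow> subst \<sigma> (replace_at t p u) = replace_at (subst \<sigma> t) p (subst \<sigma> u)"
  by (induction t p u rule: replace_at.induct) (auto simp: map_update)

section \<open>Active contexts\<close>

definition act_compatible ::
  "('p, 'f, 'v) egtrs \<Rightarrow> (('f, 'v) trm \<Rightarrow> ('f, 'v) trm \<Rightarrow> bool) \<Rightarrow> bool" where
  "act_compatible \<R> B \<longleftrightarrow> (\<forall>f ts i s t. Fun f ts \<in> terms \<R> \<longrightarrow> i \<in> repl \<R> f \<longrightarrow> B s t \<longrightarrow>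
     B (Fun f (ts[i := s])) (Fun f (ts[i := t])))"

lemma act_compatibleD:
  "act_compatible \<R> B \<Longrightarrow> Fun f ts \<in> terms \<R> \<Longrightarrow> i \<in> repl \<R> f \<Longrightarrow> B s t
    \<Longrightarrow> B (Fun f (ts[i := s])) (Fun f (ts[i := t]))"
  unfolding act_compatible_def by blast

lemma act_compatible_arg:
  "act_compatible \<R> B \<Longrightarrow> Fun f ts \<in> terms \<R> \<Longrightarrow> i \<in> repl \<R> f \<Longrightarrow> B (ts ! i) t
    \<Longrightarrow> B (Fun f ts) (Fun f (ts[i := t]))"
  using act_compatibleD[of \<R> B f ts i "ts ! i" t] by simp

lemma act_compatible_OO:
  "act_compatible \<R> B \<Longrightarrow> act_compatible \<R> C \<Longrightarrow> act_compatible \<R> (B OO C)"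
  unfolding act_compatible_def by blast

lemma act_compatible_conversep: "act_compatible \<R> B \<Longrightarrow> act_compatible \<R> B\<inverse>\<inverse>"
  unfolding act_compatible_def by blast

lemma act_compatible_rtranclp:
  assumes "act_compatible \<R> B"
  shows "act_compatible \<R> B\<^sup>*\<^sup>*"
  unfolding act_compatible_def
proof (intro allI impI)
  fix f ts i s t assume f: "Fun f ts \<in> terms \<R>" "i \<in> repl \<R> f" and "B\<^sup>*\<^sup>* s t"
  from this(3) show "B\<^sup>*\<^sup>* (Fun f (ts[i := s])) (Fun f (ts[i := t]))"
    by induction (auto intro: rtranclp.rtrancl_into_rtrancl act_compatibleD[OF assms f])
qed

inductive act_closure ::
  "('p, 'f, 'v) egtrs \<Rightarrow> (('f, 'v) trm \<Rightarrow> ('f, 'v) trm \<Rightarrow> bool) \<Rightarrow> ('f, 'v) trm \<Rightarrow> ('f, 'v) trm \<Rightarrow> bool"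
  for \<R> B where
  root: "B s t \<Longrightarrow> act_closure \<R> B s t"
| arg: "Fun f ts \<in> terms \<R> \<Longrightarrow> i \<in> repl \<R> f \<Longrightarrow> act_closure \<R> B (ts ! i) t
    \<Longrightarrow> act_closure \<R> B (Fun f ts) (Fun f (ts[i := t]))"

lemma act_closure_mono:
  "act_closure \<R> B s t \<Longrightarrow> (\<And>s t. B s t \<Longrightarrow> C s t) \<Longrightarrow> act_closure \<R> C s t"
  by (induction rule: act_closure.induct) (auto intro: act_closure.intros)

lemma act_closure_least:
  assumes "act_closure \<R> B s t" "act_compatible \<R> C" "\<And>s t. B s t \<Longrightarrow> C s t"
  shows "C s t"
  using assms(1) by induction (auto intro: assms(2,3) act_compatible_arg)

lemma act_closure_in_terms:
  assumes "act_closure \<R> B s t" "\<And>s t. B s t \<Longrightarrow> s \<in> terms \<R> \<and> t \<in> terms \<R>"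
  shows "s \<in> terms \<R> \<and> t \<in> terms \<R>"
  using assms(1) by induction (auto simp: assms(2) intro: update_in_terms)

inductive active_arg :: "('p, 'f, 'v) egtrs \<Rightarrow> ('f, 'v) trm \<Rightarrow> ('f, 'v) trm \<Rightarrow> bool" for \<R> where
  arg: "Fun f ts \<in> terms \<R> \<Longrightarrow> i \<in> repl \<R> f \<Longrightarrow> active_arg \<R> (Fun f ts) (ts ! i)"

section \<open>Horn deduction\<close>

definition clauses_for :: "'p psym \<Rightarrow> ('p, 'f, 'v) clause set \<Rightarrow> ('p, 'f, 'v) clause set" where
  "clauses_for P Th = {(A, c) \<in> Th. apred A = P}"

lemma clauses_for_Un: "clauses_for P (Th \<union> Th') = clauses_for P Th \<union> clauses_for P Th'"
  by (auto simp: clauses_for_def)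

lemma clauses_for_refl_ax: "clauses_for P (refl_ax Q) = (if P = Q then refl_ax Q else {})"
  and clauses_for_sym_ax: "clauses_for P (sym_ax Q) = (if P = Q then sym_ax Q else {})"
  and clauses_for_trans_ax: "clauses_for P (trans_ax P' Q) = (if P = Q then trans_ax P' Q else {})"
  and clauses_for_prop_ax: "clauses_for P (prop_ax \<R> Q) = (if P = Q then prop_ax \<R> Q else {})"
  and clauses_for_rule_ax: "clauses_for P (rule_ax Q rs) = (if P = Q then rule_ax Q rs else {})"
  and clauses_for_modulo_rule_ax:
    "clauses_for P (modulo_rule_ax Q rs) = (if P = Q then modulo_rule_ax Q rs else {})"
  by (auto simp: clauses_for_def refl_ax_def sym_ax_def trans_ax_def prop_ax_def rule_ax_def
      modulo_rule_ax_def)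

lemmas clauses_for_simps = clauses_for_Un clauses_for_refl_ax clauses_for_sym_ax
  clauses_for_trans_ax clauses_for_prop_ax clauses_for_rule_ax clauses_for_modulo_rule_ax

text \<open>Instances are taken relative to an arbitrary set \<open>D\<close> of atoms in which the bodies are
  evaluated, so that \<open>D\<close> can also carry the induction hypothesis of a rule induction.\<close>

definition clause_inst ::
  "('p, 'f, 'v) egtrs \<Rightarrow> (('p, 'f, 'v) atom \<Rightarrow> bool) \<Rightarrow> ('p, 'f, 'v) clause set
    \<Rightarrow> ('p, 'f, 'v) atom \<Rightarrow> bool" where
  "clause_inst \<R> D Th A \<longleftrightarrow> (\<exists>A' c. \<exists>\<sigma> \<in> substs \<R>.
     (A', c) \<in> Th \<and> A = asubst \<sigma> A' \<and> (\<forall>B \<in> set c. D (asubst \<sigma> B)))"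

definition crule_inst ::
  "('p, 'f, 'v) egtrs \<Rightarrow> (('p, 'f, 'v) atom \<Rightarrow> bool) \<Rightarrow> ('p, 'f, 'v) crule set
    \<Rightarrow> ('f, 'v) trm \<Rightarrow> ('f, 'v) trm \<Rightarrow> bool" where
  "crule_inst \<R> D rs s t \<longleftrightarrow> (\<exists>\<alpha> \<in> rs. \<exists>\<sigma> \<in> substs \<R>. \<exists>c.
     rule_subst \<sigma> \<alpha> = (s, t, c) \<and> (\<forall>B \<in> set c. D B))"

lemma crule_instI:
  "(l, r, c) \<in> rs \<Longrightarrow> \<sigma> \<in> substs \<R> \<Longrightarrow> (\<And>B. B \<in> set c \<Longrightarrow> D (asubst \<sigma> B))
    \<Longrightarrow> crule_inst \<R> D rs (subst \<sigma> l) (subst \<sigma> r)"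
  unfolding crule_inst_def by (intro bexI[of _ "(l, r, c)"] bexI[of _ \<sigma>]) auto

lemma crule_instE:
  assumes "crule_inst \<R> D rs s t"
  obtains l r c \<sigma> where "(l, r, c) \<in> rs" "\<sigma> \<in> substs \<R>" "\<forall>B \<in> set c. D (asubst \<sigma> B)"
    "s = subst \<sigma> l" "t = subst \<sigma> r"
  using assms unfolding crule_inst_def by fastforce

lemma crule_inst_mono:
  "crule_inst \<R> D rs s t \<Longrightarrow> (\<And>B. D B \<Longrightarrow> D' B) \<Longrightarrow> crule_inst \<R> D' rs s t"
  unfolding crule_inst_def by blast

lemma clause_inst_Un:
  "clause_inst \<R> D (Th \<union> Th') A \<longleftrightarrow> clause_inst \<R> D Th A \<or> clause_inst \<R> D Th' A"
  unfolding clause_inst_def by blast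

lemma clause_inst_mono:
  "clause_inst \<R> D Th A \<Longrightarrow> (\<And>B. D B \<Longrightarrow> D' B) \<Longrightarrow> clause_inst \<R> D' Th A"
  unfolding clause_inst_def by blast

lemma clause_inst_clauses_for:
  "clause_inst \<R> D (clauses_for (apred A) Th) A \<longleftrightarrow> clause_inst \<R> D Th A"
  unfolding clause_inst_def
  by (intro ex_cong1 bex_cong refl) (auto simp: clauses_for_def apred_asubst)

lemma deducible_iff_clause_inst:
  "deducible \<R> Th A \<longleftrightarrow> clause_inst \<R> (deducible \<R> Th) (clauses_for (apred A) Th) A"
  unfolding clause_inst_clauses_for by (subst deducible.simps) (auto simp: clause_inst_def)

lemma deducible_clause_induct [consumes 1, case_names clause_inst]:
  assumes "deducible \<R> Th A"
    and "\<And>A. clause_inst \<R> (\<lambda>B. deducible \<R> Th B \<and> Q B) (clauses_for (apred A) Th) A \<Longrightarrow> Q A"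
  shows "Q A"
  using assms(1)
proof induction
  case (1 A c \<sigma>)
  then show ?case
    by (intro assms(2)) (unfold clause_inst_clauses_for, auto simp: clause_inst_def)
qed

lemma deducible_transfer:
  assumes "deducible \<R> Th A" "apred A \<in> S"
    and "\<And>A c. (A, c) \<in> Th \<Longrightarrow> apred A \<in> S \<Longrightarrow> (A, c) \<in> Th' \<and> apred ` set c \<subseteq> S"
  shows "deducible \<R> Th' A"
  using assms(1,2)
proof induction
  case (1 A c \<sigma>)
  have c: "(A, c) \<in> Th'" "apred ` set c \<subseteq> S"
    using assms(3)[OF 1(1)] 1(4) by (auto simp: apred_asubst)
  then have "\<forall>B \<in> set c. deducible \<R> Th' (asubst \<sigma> B)"
    using 1(3) by (auto simp: apred_asubst)
  then show ?case using c(1) 1(2) by (blast intro: deducible.intros)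
qed

lemma deducible_in_terms:
  assumes "\<And>A c. (A, c) \<in> Th \<Longrightarrow> set (aargs A) \<subseteq> terms \<R>" "deducible \<R> Th A"
  shows "set (aargs A) \<subseteq> terms \<R>"
  using assms(2)
proof cases
  case (1 A' c \<sigma>)
  then show ?thesis using assms(1)[OF 1(2)] by (auto simp: asubst_def intro!: subst_in_terms)
qed

lemma clause_inst_refl_ax:
  "clause_inst \<R> D (refl_ax P) (bin P s t) \<longleftrightarrow> s = t \<and> s \<in> terms \<R>"
proof
  assume "s = t \<and> s \<in> terms \<R>"
  then have "(\<lambda>_. s) \<in> substs \<R>"
    "bin P s t = asubst (\<lambda>_. s) (bin P (Var undefined) (Var undefined))"
    by (auto simp: substs_def asubst_bin)
  then show "clause_inst \<R> D (refl_ax P) (bin P s t)"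
    unfolding clause_inst_def refl_ax_def by fastforce
qed (auto simp: clause_inst_def refl_ax_def asubst_bin substs_def)

lemma clause_inst_sym_ax:
  fixes s t :: "('f, 'v :: infinite) trm"
  shows "clause_inst \<R> D (sym_ax P) (bin P s t) \<longleftrightarrow> {s, t} \<subseteq> terms \<R> \<and> D (bin P t s)"
proof
  assume st: "{s, t} \<subseteq> terms \<R> \<and> D (bin P t s)"
  obtain x y \<sigma> where "x \<noteq> y" "\<sigma> \<in> substs \<R>" "\<sigma> x = t" "\<sigma> y = s"
    by (rule obtain_vars_subst[of "[t, s]" \<R>]) (use st in \<open>auto simp: map_eq_Cons_conv\<close>)
  with st show "clause_inst \<R> D (sym_ax P) (bin P s t)"
    unfolding clause_inst_def sym_ax_def
    by (intro exI[of _ "bin P (Var y) (Var x)"] exI[of _ "[bin P (Var x) (Var y)]"] bexI[of _ \<sigma>])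
      (auto simp: asubst_bin)
qed (auto simp: clause_inst_def sym_ax_def asubst_bin substs_def)

lemma clause_inst_trans_ax:
  fixes s u :: "('f, 'v :: infinite) trm"
  shows "clause_inst \<R> D (trans_ax P Q) (bin Q s u) \<longleftrightarrow>
    (\<exists>t. {s, t, u} \<subseteq> terms \<R> \<and> D (bin P s t) \<and> D (bin Q t u))"
proof
  assume "\<exists>t. {s, t, u} \<subseteq> terms \<R> \<and> D (bin P s t) \<and> D (bin Q t u)"
  then obtain t where t: "{s, t, u} \<subseteq> terms \<R>" "D (bin P s t)" "D (bin Q t u)" by blast
  obtain x y z \<sigma> where "distinct [x, y, z]" "\<sigma> \<in> substs \<R>" "\<sigma> x = s" "\<sigma> y = t" "\<sigma> z = u"
    by (rule obtain_vars_subst[of "[s, t, u]" \<R>]) (use t(1) in \<open>auto simp: map_eq_Cons_conv\<close>)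
  with t show "clause_inst \<R> D (trans_ax P Q) (bin Q s u)"
    unfolding clause_inst_def trans_ax_def
    by (intro exI[of _ "bin Q (Var x) (Var z)"]
        exI[of _ "[bin P (Var x) (Var y), bin Q (Var y) (Var z)]"] bexI[of _ \<sigma>])
      (auto simp: asubst_bin)
next
  assume "clause_inst \<R> D (trans_ax P Q) (bin Q s u)"
  then show "\<exists>t. {s, t, u} \<subseteq> terms \<R> \<and> D (bin P s t) \<and> D (bin Q t u)"
    by (fastforce simp: clause_inst_def trans_ax_def asubst_bin substs_def)
qed

lemma clause_inst_rule_ax: "clause_inst \<R> D (rule_ax P rs) (bin P s t) \<longleftrightarrow> crule_inst \<R> D rs s t"
proof
  assume "clause_inst \<R> D (rule_ax P rs) (bin P s t)"
  then show "crule_inst \<R> D rs s t"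
    by (fastforce simp: clause_inst_def rule_ax_def asubst_bin intro: crule_instI)
next
  assume "crule_inst \<R> D rs s t"
  then obtain l r c \<sigma> where inst: "(l, r, c) \<in> rs" "\<sigma> \<in> substs \<R>" "\<forall>B \<in> set c. D (asubst \<sigma> B)"
    "bin P s t = asubst \<sigma> (bin P l r)"
    by (auto simp: asubst_bin elim: crule_instE)
  moreover have "(bin P l r, c) \<in> rule_ax P rs" using inst(1) by (auto simp: rule_ax_def)
  ultimately show "clause_inst \<R> D (rule_ax P rs) (bin P s t)"
    unfolding clause_inst_def by blast
qed

lemma clause_inst_modulo_rule_ax:
  fixes s t :: "('f, 'v :: infinite) trm"
  shows "clause_inst \<R> D (modulo_rule_ax P rs) (bin P s t) \<longleftrightarrow>
    s \<in> terms \<R> \<and> (\<exists>l. D (bin Eq s l) \<and> crule_inst \<R> D rs l t)"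
proof
  assume "s \<in> terms \<R> \<and> (\<exists>l. D (bin Eq s l) \<and> crule_inst \<R> D rs l t)"
  then obtain l r c \<sigma> where s: "s \<in> terms \<R>" and inst: "(l, r, c) \<in> rs" "\<sigma> \<in> substs \<R>"
    "\<forall>B \<in> set c. D (asubst \<sigma> B)" "D (bin Eq s (subst \<sigma> l))" "t = subst \<sigma> r"
    by (auto elim: crule_instE)
  obtain x where x: "x \<notin> rule_vars (l, r, c)"
    using ex_new_if_finite[OF infinite_UNIV finite_rule_vars] by blast
  let ?\<sigma> = "\<sigma>(x := s)"
  have "rule_subst ?\<sigma> (l, r, c) = rule_subst \<sigma> (l, r, c)"
    using x by (intro rule_subst_cong) auto
  then have "\<forall>B \<in> set (bin Eq (Var x) l # c). D (asubst ?\<sigma> B)"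
      "bin P s t = asubst ?\<sigma> (bin P (Var x) r)"
    using inst by (auto simp: asubst_bin)
  moreover have "?\<sigma> \<in> substs \<R>" using inst(2) s by (simp add: substs_def)
  moreover have "(bin P (Var x) r, bin Eq (Var x) l # c) \<in> modulo_rule_ax P rs"
    using inst(1) x by (auto simp: modulo_rule_ax_def)
  ultimately show "clause_inst \<R> D (modulo_rule_ax P rs) (bin P s t)"
    unfolding clause_inst_def by blast
next
  assume "clause_inst \<R> D (modulo_rule_ax P rs) (bin P s t)"
  then show "s \<in> terms \<R> \<and> (\<exists>l. D (bin Eq s l) \<and> crule_inst \<R> D rs l t)"
    by (fastforce simp: clause_inst_def modulo_rule_ax_def asubst_bin substs_def
        intro: crule_instI)
qed

locale wf_egtrs =
  fixes \<R> :: "('p, 'f, 'v :: infinite) egtrs"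
  assumes wf: "is_egtrs \<R>"
begin

lemma repl_less: "Fun f ts \<in> terms \<R> \<Longrightarrow> i \<in> repl \<R> f \<Longrightarrow> i < length ts"
  using wf by (auto simp: is_egtrs_def Fun_in_terms_iff)

lemma Eqs_wf:
  assumes "(s, t, c) \<in> Eqs \<R>"
  shows "s \<in> terms \<R>" "t \<in> terms \<R>" "apred ` set c \<subseteq> sig_preds \<R>"
  using wf assms by (auto simp: is_egtrs_def atoms_def)

lemma Hcl_wf:
  assumes "(A, c) \<in> Hcl \<R>"
  shows "set (aargs A) \<subseteq> terms \<R>" "apred A \<in> {Approx} \<union> range Usr"
    "apred ` insert A (set c) \<subseteq> sig_preds \<R>"
  using wf assms by (auto simp: is_egtrs_def atoms_def sig_preds_def)

lemma Rls_rm_wf: "(l, r, c) \<in> Rls_rm \<R> \<Longrightarrow> l \<in> terms \<R> \<and> r \<in> terms \<R>"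
  using wf by (auto simp: is_egtrs_def Rls_rm_def)

lemma sym_rules_wf: "(l, r, c) \<in> sym_rules \<R> \<Longrightarrow> l \<in> terms \<R> \<and> r \<in> terms \<R>"
  by (auto simp: sym_rules_def dest: Eqs_wf)

lemma Eq_independent: "\<not> depends_on_R \<R> Eq"
  using wf by (simp add: is_egtrs_def)

lemma clause_inst_prop_ax:
  "clause_inst \<R> D (prop_ax \<R> P) A \<longleftrightarrow> (\<exists>f ts i t. A = bin P (Fun f ts) (Fun f (ts[i := t])) \<and>
    Fun f ts \<in> terms \<R> \<and> i \<in> repl \<R> f \<and> t \<in> terms \<R> \<and> D (bin P (ts ! i) t))"
proof
  assume "clause_inst \<R> D (prop_ax \<R> P) A"
  then obtain f i xs y \<sigma> where inst: "f \<in> Fsig \<R>" "i \<in> repl \<R> f" "length xs = far \<R> f"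
    "\<sigma> \<in> substs \<R>" "A = asubst \<sigma> (bin P (Fun f (map Var xs)) (Fun f (map Var (xs[i := y]))))"
    "D (asubst \<sigma> (bin P (Var (xs ! i)) (Var y)))"
    by (auto simp: clause_inst_def prop_ax_def)
  have f: "Fun f (map \<sigma> xs) \<in> terms \<R>" using inst by (auto simp: Fun_in_terms_iff substs_def)
  then have "i < length xs" using repl_less inst(2) by fastforce
  with inst f show "\<exists>f ts i t. A = bin P (Fun f ts) (Fun f (ts[i := t])) \<and>
      Fun f ts \<in> terms \<R> \<and> i \<in> repl \<R> f \<and> t \<in> terms \<R> \<and> D (bin P (ts ! i) t)"
    by (intro exI[of _ f] exI[of _ "map \<sigma> xs"] exI[of _ i] exI[of _ "\<sigma> y"])
      (auto simp: asubst_bin comp_def map_update substs_def)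
next
  assume "\<exists>f ts i t. A = bin P (Fun f ts) (Fun f (ts[i := t])) \<and>
    Fun f ts \<in> terms \<R> \<and> i \<in> repl \<R> f \<and> t \<in> terms \<R> \<and> D (bin P (ts ! i) t)"
  then obtain f ts i t where A: "A = bin P (Fun f ts) (Fun f (ts[i := t]))"
    "Fun f ts \<in> terms \<R>" "i \<in> repl \<R> f" "t \<in> terms \<R>" "D (bin P (ts ! i) t)" by blast
  have "set (t # ts) \<subseteq> terms \<R>" using A(2,4) by (simp add: Fun_in_terms_iff)
  then obtain y xs \<sigma> where \<sigma>: "distinct (y # xs)" "\<sigma> \<in> substs \<R>" "map \<sigma> xs = ts" "\<sigma> y = t"
    by (rule obtain_vars_subst) (auto simp: map_eq_Cons_conv)
  let ?A = "bin P (Fun f (map Var xs)) (Fun f (map Var (xs[i := y])))"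
  let ?B = "bin P (Var (xs ! i)) (Var y) :: ('p, 'f, 'v) atom"
  have "(?A, [?B]) \<in> prop_ax \<R> P"
    using A \<sigma> unfolding prop_ax_def Fun_in_terms_iff by fastforce
  moreover have "asubst \<sigma> ?A = A" "asubst \<sigma> ?B = bin P (ts ! i) t"
    using A(1) \<sigma>(3,4) repl_less[OF A(2,3)] by (auto simp: asubst_bin comp_def map_update)
  ultimately show "clause_inst \<R> D (prop_ax \<R> P) A"
    unfolding clause_inst_def using \<sigma>(2) A(5)
    by (intro exI[of _ ?A] exI[of _ "[?B]"] bexI[of _ \<sigma>]) auto
qed

lemma clause_inst_eq_ax:
  "clause_inst \<R> D (eq_ax \<R>) (bin Eq s t) \<longleftrightarrow>
    s = t \<and> s \<in> terms \<R> \<or>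
    {s, t} \<subseteq> terms \<R> \<and> D (bin Eq t s) \<or>
    (\<exists>u. {s, u, t} \<subseteq> terms \<R> \<and> D (bin Eq s u) \<and> D (bin Eq u t)) \<or>
    clause_inst \<R> D (prop_ax \<R> Eq) (bin Eq s t) \<or>
    crule_inst \<R> D (Eqs \<R>) s t"
  by (simp add: eq_ax_def clause_inst_Un clause_inst_refl_ax clause_inst_sym_ax
      clause_inst_trans_ax clause_inst_rule_ax)

lemma act_compatible_deducible:
  assumes "\<And>A c. (A, c) \<in> Th \<Longrightarrow> set (aargs A) \<subseteq> terms \<R>" "prop_ax \<R> P \<subseteq> Th"
  shows "act_compatible \<R> (\<lambda>s t. deducible \<R> Th (bin P s t))"
  unfolding act_compatible_def
proof (intro allI impI)
  fix f ts i s t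
  assume f: "Fun f ts \<in> terms \<R>" "i \<in> repl \<R> f" and d: "deducible \<R> Th (bin P s t)"
  have "s \<in> terms \<R>" "t \<in> terms \<R>" using deducible_in_terms[OF assms(1) d] by auto
  then have "clause_inst \<R> (deducible \<R> Th) (prop_ax \<R> P)
      (bin P (Fun f (ts[i := s])) (Fun f (ts[i := s, i := t])))"
    unfolding clause_inst_prop_ax using f d repl_less[OF f] update_in_terms[OF f(1)]
    by (intro exI[of _ f] exI[of _ "ts[i := s]"] exI[of _ i] exI[of _ t]) simp
  moreover have "clauses_for P (prop_ax \<R> P) \<subseteq> clauses_for P Th"
    using assms(2) by (auto simp: clauses_for_def)
  ultimately have "clause_inst \<R> (deducible \<R> Th) (clauses_for P Th)
      (bin P (Fun f (ts[i := s])) (Fun f (ts[i := t])))"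
    by (auto simp: clause_inst_def clauses_for_prop_ax)
  then show "deducible \<R> Th (bin P (Fun f (ts[i := s])) (Fun f (ts[i := t])))"
    by (subst deducible_iff_clause_inst) simp
qed

lemma deducible_imp_act_closure:
  assumes clauses: "clauses_for P Th = prop_ax \<R> P \<union> C" and "deducible \<R> Th (bin P s t)"
  shows "act_closure \<R> (\<lambda>s t. clause_inst \<R> (deducible \<R> Th) C (bin P s t)) s t"
proof -
  let ?closure = "act_closure \<R> (\<lambda>s t. clause_inst \<R> (deducible \<R> Th) C (bin P s t))"
  have "\<forall>s t. A = bin P s t \<longrightarrow> ?closure s t" if "deducible \<R> Th A" for A
    using that
  proof (induction A rule: deducible_clause_induct)
    case (clause_inst A)
    show ?case
    proof (intro allI impI)
      fix s t assume A: "A = bin P s t"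
      let ?D = "\<lambda>B. deducible \<R> Th B \<and> (\<forall>s t. B = bin P s t \<longrightarrow> ?closure s t)"
      from clause_inst A consider (propagation) "clause_inst \<R> ?D (prop_ax \<R> P) A"
        | (root) "clause_inst \<R> ?D C A"
        by (auto simp: clauses clause_inst_Un)
      then show "?closure s t"
      proof cases
        case propagation
        then show ?thesis unfolding clause_inst_prop_ax using A by (auto intro: act_closure.arg)
      next
        case root
        then show ?thesis using A by (auto elim: clause_inst_mono intro: act_closure.root)
      qed
    qed
  qed
  then show ?thesis using assms(2) by blast
qed

lemma deducible_iff_act_closure:
  assumes "clauses_for P Th = prop_ax \<R> P \<union> C"
    and "\<And>A c. (A, c) \<in> Th \<Longrightarrow> set (aargs A) \<subseteq> terms \<R>"
  shows "deducible \<R> Th (bin P s t) \<longleftrightarrow>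
    act_closure \<R> (\<lambda>s t. clause_inst \<R> (deducible \<R> Th) C (bin P s t)) s t"
proof
  assume "act_closure \<R> (\<lambda>s t. clause_inst \<R> (deducible \<R> Th) C (bin P s t)) s t"
  moreover have "prop_ax \<R> P \<subseteq> Th"
    using assms(1) by (auto simp: clauses_for_def)
  then have "act_compatible \<R> (\<lambda>s t. deducible \<R> Th (bin P s t))"
    using act_compatible_deducible assms(2) by blast
  moreover have "deducible \<R> Th (bin P s t)"
    if "clause_inst \<R> (deducible \<R> Th) C (bin P s t)" for s t
    by (subst deducible_iff_clause_inst) (use that assms(1) in \<open>simp add: clause_inst_Un\<close>)
  ultimately show "deducible \<R> Th (bin P s t)"
    by (rule act_closure_least)
qed (rule deducible_imp_act_closure[OF assms(1)])

section \<open>The theory of an EGTRS\<close>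

abbreviation "ded \<equiv> deducible \<R> (Th_CR \<R>)"
abbreviation "equal s t \<equiv> ded (bin Eq s t)"
abbreviation "rule_root_step \<equiv> crule_inst \<R> ded (Rls_rm \<R>)"
abbreviation "E_step \<equiv> act_closure \<R> (crule_inst \<R> ded (sym_rules \<R>))"

definition modulo_root_step :: "('f, 'v) trm \<Rightarrow> ('f, 'v) trm \<Rightarrow> bool" where
  "modulo_root_step s t \<longleftrightarrow> (\<exists>l. equal s l \<and> rule_root_step l t)"

lemma Hcl_rm_head:
  assumes "(A, c) \<in> Hcl_rm \<R>"
  shows "apred A \<in> {Approx, ApproxRm} \<union> range Usr" "set (aargs A) \<subseteq> terms \<R>"
  using assms Hcl_wf(1,2) by (fastforce simp: Hcl_rm_def map_pred_def)+

lemma clauses_for_Hcl_rm: "P \<in> {Eq, Rew, RewPs, RewRm} \<Longrightarrow> clauses_for P (Hcl_rm \<R>) = {}"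
  by (auto simp: clauses_for_def dest: Hcl_rm_head(1))

lemma clauses_for_rm_ax:
  "P \<notin> {RewRm, RewsRm} \<Longrightarrow> clauses_for P (rm_ax :: ('p, 'f, 'v) clause set) = {}"
  by (auto simp: clauses_for_def rm_ax_def refl_ax_def trans_ax_def)

lemma
  shows clauses_for_Eq: "clauses_for Eq (Th_CR \<R>) = eq_ax \<R>"
    and clauses_for_Rew: "clauses_for Rew (Th_CR \<R>) = prop_ax \<R> Rew \<union> rule_ax Rew (Rls_rm \<R>)"
    and clauses_for_RewPs:
      "clauses_for RewPs (Th_CR \<R>) = prop_ax \<R> RewPs \<union> modulo_rule_ax RewPs (Rls_rm \<R>)"
    and clauses_for_RewRm: "clauses_for RewRm (Th_CR \<R>) = clauses_for RewRm rm_ax"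
  by (simp_all add: Th_CR_def eq_ax_def rew_ax_def ps_ax_def clauses_for_simps
      clauses_for_Hcl_rm clauses_for_rm_ax)

lemma Th_CR_head_in_terms:
  assumes "(A, c) \<in> Th_CR \<R>"
  shows "set (aargs A) \<subseteq> terms \<R>"
proof (cases "(A, c) \<in> Hcl_rm \<R>")
  case False
  have prop_ax: "(A, c) \<in> prop_ax \<R> P \<Longrightarrow> ?thesis" for P
    by (auto simp: prop_ax_def Fun_in_terms_iff terms.intros(1))
  show ?thesis using assms False
    unfolding Th_CR_def eq_ax_def rew_ax_def ps_ax_def rm_ax_def
    by (elim UnE)
      (auto simp: refl_ax_def sym_ax_def trans_ax_def rule_ax_def modulo_rule_ax_def
        dest: Eqs_wf Rls_rm_wf intro: terms.intros prop_ax[THEN subsetD])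
qed (simp add: Hcl_rm_head)

lemma ded_bin_in_terms: "ded (bin P s t) \<Longrightarrow> s \<in> terms \<R> \<and> t \<in> terms \<R>"
  using deducible_in_terms[OF Th_CR_head_in_terms] by fastforce

lemma equal_iff: "equal s t \<longleftrightarrow> clause_inst \<R> ded (eq_ax \<R>) (bin Eq s t)"
  by (subst deducible_iff_clause_inst) (simp add: clauses_for_Eq)

lemma equal_refl: "s \<in> terms \<R> \<Longrightarrow> equal s s"
  by (rule equal_iff[THEN iffD2]) (simp add: clause_inst_eq_ax)

lemma equal_sym: "equal s t \<Longrightarrow> equal t s"
  by (rule equal_iff[THEN iffD2]) (simp add: clause_inst_eq_ax ded_bin_in_terms)

lemma equal_trans: "equal s t \<Longrightarrow> equal t u \<Longrightarrow> equal s u"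
  by (rule equal_iff[THEN iffD2]) (auto simp: clause_inst_eq_ax dest: ded_bin_in_terms)

lemma act_compatible_ded:
  "P \<in> {Eq, Rew, RewPs} \<Longrightarrow> act_compatible \<R> (\<lambda>s t. ded (bin P s t))"
  using Th_CR_head_in_terms
  by (intro act_compatible_deducible) (auto simp: Th_CR_def eq_ax_def rew_ax_def ps_ax_def)

lemma act_compatible_equal: "act_compatible \<R> equal"
  using act_compatible_ded by simp

lemma act_compatible_step_RE: "act_compatible \<R> (step_RE \<R>)"
  using act_compatible_ded[of RewPs] by (simp add: step_RE_def[abs_def])

lemma step_R_iff: "step_R \<R> s t \<longleftrightarrow> act_closure \<R> rule_root_step s t"
  unfolding step_R_def
  using deducible_iff_act_closure[OF clauses_for_Rew Th_CR_head_in_terms]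
  by (simp add: clause_inst_rule_ax)

lemma step_RE_iff: "step_RE \<R> s t \<longleftrightarrow> act_closure \<R> modulo_root_step s t"
proof -
  have "modulo_root_step =
      (\<lambda>s t. clause_inst \<R> ded (modulo_rule_ax RewPs (Rls_rm \<R>)) (bin RewPs s t))"
    using ded_bin_in_terms
    by (intro ext) (auto simp: modulo_root_step_def clause_inst_modulo_rule_ax)
  then show ?thesis
    unfolding step_RE_def
    using deducible_iff_act_closure[OF clauses_for_RewPs Th_CR_head_in_terms] by simp
qed

lemma clause_inst_RewRm:
  "clause_inst \<R> D (clauses_for RewRm rm_ax) (bin RewRm s t) \<longleftrightarrow>
    (\<exists>s' t'. {s, s', t', t} \<subseteq> terms \<R> \<and> D (bin Eq s s') \<and> D (bin Rew s' t') \<and> D (bin Eq t' t))"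
proof
  assume "clause_inst \<R> D (clauses_for RewRm rm_ax) (bin RewRm s t)"
  then show "\<exists>s' t'. {s, s', t', t} \<subseteq> terms \<R> \<and>
      D (bin Eq s s') \<and> D (bin Rew s' t') \<and> D (bin Eq t' t)"
    by (fastforce simp: clause_inst_def clauses_for_def rm_ax_def refl_ax_def trans_ax_def
        asubst_bin substs_def)
next
  assume "\<exists>s' t'. {s, s', t', t} \<subseteq> terms \<R> \<and>
    D (bin Eq s s') \<and> D (bin Rew s' t') \<and> D (bin Eq t' t)"
  then obtain s' t' where st: "{s, s', t', t} \<subseteq> terms \<R>"
    "D (bin Eq s s')" "D (bin Rew s' t')" "D (bin Eq t' t)" by blast
  obtain x x' y' y \<sigma> where "distinct [x, x', y', y]" and \<sigma>: "\<sigma> \<in> substs \<R>"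
    "\<sigma> x = s" "\<sigma> x' = s'" "\<sigma> y' = t'" "\<sigma> y = t"
    by (rule obtain_vars_subst[of "[s, s', t', t]" \<R>])
      (use st(1) in \<open>auto simp: map_eq_Cons_conv\<close>)
  then have "(bin RewRm (Var x) (Var y),
      [bin Eq (Var x) (Var x'), bin Rew (Var x') (Var y'), bin Eq (Var y') (Var y)])
    \<in> clauses_for RewRm rm_ax"
    unfolding clauses_for_def rm_ax_def by fastforce
  then show "clause_inst \<R> D (clauses_for RewRm rm_ax) (bin RewRm s t)"
    unfolding clause_inst_def using st \<sigma>
    by (intro exI conjI bexI[of _ \<sigma>]) (auto simp: asubst_bin)
qed

lemma step_RmodE_iff_step_R:
  "step_RmodE \<R> s t \<longleftrightarrow> (\<exists>s' t'. equal s s' \<and> step_R \<R> s' t' \<and> equal t' t)"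
proof -
  have "step_RmodE \<R> s t \<longleftrightarrow> clause_inst \<R> ded (clauses_for RewRm rm_ax) (bin RewRm s t)"
    unfolding step_RmodE_def by (subst deducible_iff_clause_inst) (simp add: clauses_for_RewRm)
  then show ?thesis
    using ded_bin_in_terms unfolding clause_inst_RewRm step_R_def by blast
qed

lemma step_RE_in_terms: "step_RE \<R> s t \<Longrightarrow> s \<in> terms \<R> \<and> t \<in> terms \<R>"
  by (simp add: step_RE_def ded_bin_in_terms)

lemma crule_inst_in_terms:
  assumes "\<And>l r c. (l, r, c) \<in> rs \<Longrightarrow> l \<in> terms \<R> \<and> r \<in> terms \<R>" "crule_inst \<R> D rs s t"
  shows "s \<in> terms \<R> \<and> t \<in> terms \<R>"
proof -
  from assms(2) obtain l r c \<sigma> where "(l, r, c) \<in> rs" "\<sigma> \<in> substs \<R>" "s = subst \<sigma> l" "t = subst \<sigma> r"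
    by (rule crule_instE)
  then show ?thesis using assms(1) by (simp add: subst_in_terms)
qed

lemma step_R_imp_step_RE: "step_R \<R> s t \<Longrightarrow> step_RE \<R> s t"
  unfolding step_R_iff step_RE_iff
proof (erule act_closure_mono)
  fix s t assume st: "rule_root_step s t"
  then have "equal s s" using crule_inst_in_terms[OF Rls_rm_wf st] equal_refl by simp
  then show "modulo_root_step s t" using st unfolding modulo_root_step_def by blast
qed

lemma step_RE_imp_equal_step_R: "step_RE \<R> s t \<Longrightarrow> (equal OO step_R \<R>) s t"
  unfolding step_RE_iff
proof (erule act_closure_least)
  show "act_compatible \<R> (equal OO step_R \<R>)"
    using act_compatible_equal act_compatible_ded[of Rew]
    by (auto simp: step_R_def[abs_def] intro: act_compatible_OO)
qed (auto simp: modulo_root_step_def step_R_iff intro: act_closure.root)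

lemma step_RmodE_iff:
  "step_RmodE \<R> s t \<longleftrightarrow> (\<exists>s' t'. equal s s' \<and> step_RE \<R> s' t' \<and> equal t' t)"
proof
  assume "\<exists>s' t'. equal s s' \<and> step_RE \<R> s' t' \<and> equal t' t"
  then show "step_RmodE \<R> s t"
    unfolding step_RmodE_iff_step_R
    using step_RE_imp_equal_step_R equal_trans by blast
qed (use step_RmodE_iff_step_R step_R_imp_step_RE in blast)

lemma act_compatible_step_RmodE: "act_compatible \<R> (step_RmodE \<R>)"
proof -
  have "step_RmodE \<R> = equal OO step_RE \<R> OO equal"
    by (intro ext) (auto simp: step_RmodE_iff)
  then show ?thesis
    by (simp add: act_compatible_OO act_compatible_equal act_compatible_step_RE)
qed

section \<open>Equational steps\<close>

definition independent_preds :: "'p psym set" where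
  "independent_preds = {P \<in> sig_preds \<R>. \<not> depends_on_R \<R> P}"

lemma independent_bodies:
  assumes "(A, c) \<in> eq_ax \<R> \<union> Hcl \<R>" "apred A \<in> independent_preds"
  shows "apred ` set c \<subseteq> independent_preds"
proof
  fix P assume "P \<in> apred ` set c"
  then obtain B where B: "B \<in> set c" "P = apred B" by blast
  from assms(1) show "P \<in> independent_preds"
  proof
    assume "(A, c) \<in> Hcl \<R>"
    then show ?thesis
      using B assms(2) Hcl_wf(3) depends_on_R.intros(4) unfolding independent_preds_def by fastforce
  next
    assume "(A, c) \<in> eq_ax \<R>"
    then consider (eq) "P = Eq" | (equation) s t where "(s, t, c) \<in> Eqs \<R>"
      using B
      unfolding eq_ax_def refl_ax_def sym_ax_def trans_ax_def prop_ax_def rule_ax_def by auto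
    then show ?thesis
    proof cases
      case eq
      then show ?thesis using Eq_independent by (simp add: independent_preds_def sig_preds_def)
    next
      case (equation s t)
      then show ?thesis
        using B Eqs_wf(3) Eq_independent depends_on_R.intros(3)
        unfolding independent_preds_def by fastforce
    qed
  qed
qed

lemma map_pred_independent:
  "apred B \<in> independent_preds \<Longrightarrow> map_pred (rm_all \<R>) B = B"
  by (cases B; cases "apred B")
    (auto simp: map_pred_def independent_preds_def sig_preds_def depends_on_R.intros)

lemma independent_if_map_pred_independent:
  assumes "apred (map_pred (rm_all \<R>) A) \<in> independent_preds" "(A, c) \<in> Hcl \<R>"
  shows "apred A \<in> independent_preds"
  using Hcl_wf(2)[OF assms(2)] assms(1)
  by (auto simp: map_pred_def independent_preds_def sig_preds_def split: if_splits)

lemma Hcl_rm_independent: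
  assumes "apred A \<in> independent_preds"
  shows "(A, c) \<in> Hcl_rm \<R> \<longleftrightarrow> (A, c) \<in> Hcl \<R>"
proof -
  have unchanged: "map_pred (rm_all \<R>) A' = A'" "map (map_pred (rm_all \<R>)) c' = c'"
    if "(A', c') \<in> Hcl \<R>" "apred A' \<in> independent_preds" for A' c'
    using that independent_bodies[of A' c'] by (auto intro!: map_idI map_pred_independent)
  show ?thesis
  proof
    assume "(A, c) \<in> Hcl_rm \<R>"
    then obtain A' c' where A': "(A', c') \<in> Hcl \<R>" "A = map_pred (rm_all \<R>) A'"
      "c = map (map_pred (rm_all \<R>)) c'" by (auto simp: Hcl_rm_def)
    then show "(A, c) \<in> Hcl \<R>"
      using unchanged[OF A'(1)]
        independent_if_map_pred_independent[OF assms[unfolded A'(2)] A'(1)] by simp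
  next
    assume A: "(A, c) \<in> Hcl \<R>"
    then have "(map_pred (rm_all \<R>) A, map (map_pred (rm_all \<R>)) c) \<in> Hcl_rm \<R>"
      unfolding Hcl_rm_def by blast
    then show "(A, c) \<in> Hcl_rm \<R>" by (simp add: unchanged[OF A assms])
  qed
qed

lemma Th_CR_independent:
  assumes "apred A \<in> independent_preds"
  shows "(A, c) \<in> Th_CR \<R> \<longleftrightarrow> (A, c) \<in> eq_ax \<R> \<union> Hcl \<R>"
proof -
  have "(A, c) \<notin> rew_ax \<R> (Rls_rm \<R>) \<union> ps_ax \<R> \<union> rm_ax"
    using assms
    by (auto simp: independent_preds_def sig_preds_def rew_ax_def ps_ax_def rm_ax_def refl_ax_def
        trans_ax_def prop_ax_def rule_ax_def modulo_rule_ax_def depends_on_R.intros)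
  then show ?thesis using Hcl_rm_independent[OF assms] by (auto simp: Th_CR_def)
qed

lemma eq_E_iff: "eq_E \<R> s t \<longleftrightarrow> equal s t"
proof -
  have Eq: "apred (bin Eq s t) \<in> independent_preds"
    using Eq_independent by (simp add: independent_preds_def sig_preds_def)
  show ?thesis
    unfolding eq_E_def
  proof
    assume "deducible \<R> (eq_ax \<R> \<union> Hcl \<R>) (bin Eq s t)"
    then show "equal s t"
      by (rule deducible_transfer[OF _ Eq]) (use Th_CR_independent independent_bodies in blast)
  next
    assume "equal s t"
    then show "deducible \<R> (eq_ax \<R> \<union> Hcl \<R>) (bin Eq s t)"
      by (rule deducible_transfer[OF _ Eq]) (use Th_CR_independent independent_bodies in blast)
  qed
qed

lemma crule_inst_sym_rules:
  "crule_inst \<R> D (sym_rules \<R>) s t \<longleftrightarrow> crule_inst \<R> D (Eqs \<R>) s t \<or> crule_inst \<R> D (Eqs \<R>) t s"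
  by (auto simp: sym_rules_def elim!: crule_instE intro: crule_instI)

lemma act_compatible_act_closure:
  assumes "\<And>s t. B s t \<Longrightarrow> s \<in> terms \<R> \<and> t \<in> terms \<R>"
  shows "act_compatible \<R> (act_closure \<R> B)"
  unfolding act_compatible_def
proof (intro allI impI)
  fix f ts i s t assume f: "Fun f ts \<in> terms \<R>" "i \<in> repl \<R> f" and st: "act_closure \<R> B s t"
  have s: "Fun f (ts[i := s]) \<in> terms \<R>"
    using act_closure_in_terms[OF st assms] update_in_terms[OF f(1)] by blast
  have "act_closure \<R> B (ts[i := s] ! i) t" using st repl_less[OF f] by simp
  from act_closure.arg[OF s f(2) this]
  show "act_closure \<R> B (Fun f (ts[i := s])) (Fun f (ts[i := t]))"
    by simp
qed

lemma E_step_imp_equal: "E_step s t \<Longrightarrow> equal s t"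
proof (erule act_closure_least[OF _ act_compatible_equal])
  have "equal s t" if "crule_inst \<R> ded (Eqs \<R>) s t" for s t
    using that by (intro equal_iff[THEN iffD2]) (simp add: clause_inst_eq_ax)
  then show "equal s t" if "crule_inst \<R> ded (sym_rules \<R>) s t" for s t
    using that equal_sym by (auto simp: crule_inst_sym_rules)
qed

lemma act_compatible_E_step: "act_compatible \<R> E_step"
  using crule_inst_in_terms[OF sym_rules_wf] by (rule act_compatible_act_closure)

lemma E_step_sym: "E_step s t \<Longrightarrow> E_step t s"
proof (erule act_closure_least[of _ _ _ _ "E_step\<inverse>\<inverse>", THEN conversepD])
  show "act_compatible \<R> E_step\<inverse>\<inverse>"
    using act_compatible_E_step by (rule act_compatible_conversep)
  show "E_step\<inverse>\<inverse> s t" if "crule_inst \<R> ded (sym_rules \<R>) s t" for s t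
    using that by (auto simp: crule_inst_sym_rules intro: act_closure.root)
qed

lemma E_steps_sym: "E_step\<^sup>*\<^sup>* s t \<Longrightarrow> E_step\<^sup>*\<^sup>* t s"
  using symp_rtranclp[OF sympI[of E_step]] E_step_sym by (blast dest: sympD)

lemma equal_imp_E_steps: "equal s t \<Longrightarrow> E_step\<^sup>*\<^sup>* s t"
proof -
  have "\<forall>s t. A = bin Eq s t \<longrightarrow> E_step\<^sup>*\<^sup>* s t" if "ded A" for A
    using that
  proof (induction A rule: deducible_clause_induct)
    case (clause_inst A)
    show ?case
    proof (intro allI impI)
      fix s t assume A: "A = bin Eq s t"
      let ?D = "\<lambda>B. ded B \<and> (\<forall>s t. B = bin Eq s t \<longrightarrow> E_step\<^sup>*\<^sup>* s t)"
      have "clause_inst \<R> ?D (eq_ax \<R>) (bin Eq s t)"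
        using clause_inst A by (simp add: clauses_for_Eq)
      then show "E_step\<^sup>*\<^sup>* s t"
        unfolding clause_inst_eq_ax
      proof (elim disjE)
        assume "{s, t} \<subseteq> terms \<R> \<and> ?D (bin Eq t s)"
        then show ?thesis using E_steps_sym by blast
      next
        assume "\<exists>u. {s, u, t} \<subseteq> terms \<R> \<and> ?D (bin Eq s u) \<and> ?D (bin Eq u t)"
        then show ?thesis by (auto intro: rtranclp_trans)
      next
        assume "clause_inst \<R> ?D (prop_ax \<R> Eq) (bin Eq s t)"
        then show ?thesis
          unfolding clause_inst_prop_ax
          using act_compatible_arg[OF act_compatible_rtranclp[OF act_compatible_E_step]] by auto
      next
        assume "crule_inst \<R> ?D (Eqs \<R>) s t"
        then have "crule_inst \<R> ded (Eqs \<R>) s t" by (auto elim: crule_inst_mono)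
        then have "E_step s t" by (simp add: crule_inst_sym_rules act_closure.root)
        then show ?thesis by blast
      qed simp
    qed
  qed
  then show "equal s t \<Longrightarrow> E_step\<^sup>*\<^sup>* s t" by blast
qed

lemma sym_rules_conditions_independent:
  "(l, r, c) \<in> sym_rules \<R> \<Longrightarrow> B \<in> set c \<Longrightarrow> \<not> depends_on_R \<R> (apred B)"
  using Eq_independent by (auto simp: sym_rules_def dest: depends_on_R.intros(3))

lemma deducible_rew_ax_depends_on_R:
  "deducible \<R> (rew_ax \<R> rs) A \<Longrightarrow> depends_on_R \<R> (apred A)"
  by (erule deducible.cases)
    (auto simp: rew_ax_def refl_ax_def trans_ax_def prop_ax_def rule_ax_def apred_asubst
      intro: depends_on_R.intros)

text \<open>The theory of \<open>step_E\<close> only proves rewriting atoms, and these do not occur in conditions of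
  equations. Hence \<open>step_E\<close> only applies unconditional equations.\<close>

lemma step_E_imp_equal:
  assumes "step_E \<R> s t"
  shows "equal s t"
proof -
  let ?D = "deducible \<R> (rew_ax \<R> (sym_rules \<R>))"
  have "crule_inst \<R> ded (sym_rules \<R>) s t" if "crule_inst \<R> ?D (sym_rules \<R>) s t" for s t
    using that
  proof (rule crule_instE)
    fix l r c \<sigma>
    assume inst: "(l, r, c) \<in> sym_rules \<R>" "\<sigma> \<in> substs \<R>" "s = subst \<sigma> l" "t = subst \<sigma> r"
      and conditions: "\<forall>B \<in> set c. ?D (asubst \<sigma> B)"
    have "B \<notin> set c" for B
      using sym_rules_conditions_independent[OF inst(1), of B] conditions
        deducible_rew_ax_depends_on_R[of "sym_rules \<R>" "asubst \<sigma> B"] by (auto simp: apred_asubst)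
    then show ?thesis unfolding inst(3,4) using inst(1,2) by (blast intro: crule_instI)
  qed
  moreover have "act_closure \<R> (crule_inst \<R> ?D (sym_rules \<R>)) s t"
    using assms deducible_imp_act_closure[of Rew _ "rule_ax Rew (sym_rules \<R>)"]
    by (simp add: step_E_def rew_ax_def clauses_for_simps clause_inst_rule_ax)
  ultimately show ?thesis using act_closure_mono E_step_imp_equal by blast
qed

lemma rewriting_modulo_equal: "rewriting_modulo equal (step_RE \<R>)"
  using equal_sym equal_trans equal_refl step_RE_in_terms by unfold_locales blast+

lemma joinable_eq_RE_joinable: "rewriting_modulo.joinable equal (step_RE \<R>) = RE_joinable \<R>"
  by (simp add: fun_eq_iff rewriting_modulo.joinable_def[OF rewriting_modulo_equal]
      RE_joinable_def eq_E_iff)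

lemma step_mod_eq_step_RmodE: "rewriting_modulo.step_mod equal (step_RE \<R>) = step_RmodE \<R>"
  by (simp add: fun_eq_iff rewriting_modulo.step_mod_def[OF rewriting_modulo_equal] step_RmodE_iff)

sublocale rewriting_modulo equal "step_RE \<R>"
  rewrites "rewriting_modulo.joinable equal (step_RE \<R>) = RE_joinable \<R>"
    and "rewriting_modulo.step_mod equal (step_RE \<R>) = step_RmodE \<R>"
  by (rule rewriting_modulo_equal joinable_eq_RE_joinable step_mod_eq_step_RmodE)+

lemma act_compatible_RE_joinable: "act_compatible \<R> (RE_joinable \<R>)"
proof -
  have "RE_joinable \<R> = (step_RE \<R>)\<^sup>*\<^sup>* OO equal OO ((step_RE \<R>)\<^sup>*\<^sup>*)\<inverse>\<inverse>"
    by (intro ext) (auto simp: joinable_def)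
  then show ?thesis
    by (simp add: act_compatible_OO act_compatible_equal act_compatible_step_RE
        act_compatible_rtranclp act_compatible_conversep)
qed

section \<open>Critical peaks\<close>

lemma act_closure_subst_cases:
  assumes "act_closure \<R> B (subst \<sigma> l) e"
  obtains (fun_pos) p v where "p \<in> active_fun_pos (repl \<R>) l" "B (subst \<sigma> (subt_at l p)) v"
      "e = replace_at (subst \<sigma> l) p v"
    | (var_pos) x p v where "p \<in> active_var_pos (repl \<R>) x l" "act_closure \<R> B (\<sigma> x) v"
      "e = replace_at (subst \<sigma> l) p v"
  using assms
proof (induction l arbitrary: e thesis)
  case (Var x)
  show ?case by (rule Var(2)[of "[]" x e]) (use Var(3) in \<open>auto simp: active_var_pos_def\<close>)
next
  case (Fun f ls)
  from Fun.prems(3) have "act_closure \<R> B (Fun f (map (subst \<sigma>) ls)) e" by simp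
  then show ?case
  proof (cases rule: act_closure.cases)
    case root
    show ?thesis
      by (rule Fun.prems(1)[of "[]" e]) (use root in \<open>auto simp: active_fun_pos_def\<close>)
  next
    case (arg i t)
    have i: "i < length ls" using repl_less[OF arg(2,3)] by simp
    then have t: "act_closure \<R> B (subst \<sigma> (ls ! i)) t" using arg(4) by simp
    show ?thesis
    proof (rule Fun.IH[OF nth_mem[OF i] _ _ t])
      fix p v assume "p \<in> active_fun_pos (repl \<R>) (ls ! i)" "B (subst \<sigma> (subt_at (ls ! i) p)) v"
        "t = replace_at (subst \<sigma> (ls ! i)) p v"
      then show ?thesis
        using i arg by (intro Fun.prems(1)[of "i # p" v]) (auto simp: active_fun_pos_def)
    next
      fix x p v assume "p \<in> active_var_pos (repl \<R>) x (ls ! i)" "act_closure \<R> B (\<sigma> x) v"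
        "t = replace_at (subst \<sigma> (ls ! i)) p v"
      then show ?thesis
        using i arg by (intro Fun.prems(2)[of "i # p" x v]) (auto simp: active_var_pos_def)
    qed
  qed
qed

lemma crule_inst_lccps:
  assumes rule: "(l, r, c) \<in> rs" "\<sigma> \<in> substs \<R>" "\<forall>B \<in> set c. D (asubst \<sigma> B)"
    and p: "p \<in> active_fun_pos (repl \<R>) l"
    and eq: "D (bin Eq (subst \<sigma> (subt_at l p)) u)" and rule': "crule_inst \<R> D rs' u v"
  shows "crule_inst \<R> D (lccps \<R> rs rs') (replace_at (subst \<sigma> l) p v) (subst \<sigma> r)"
proof -
  obtain \<alpha>' \<sigma>' d where \<alpha>': "\<alpha>' \<in> rs'" "\<sigma>' \<in> substs \<R>"
    "rule_subst \<sigma>' \<alpha>' = (u, v, d)" "\<forall>B \<in> set d. D B"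
    using rule' unfolding crule_inst_def by blast
  obtain l' r' c' \<tau> where variant: "(l', r', c') \<in> variants rs'" "\<tau> \<in> substs \<R>"
    and apart: "rule_vars (l, r, c) \<inter> rule_vars (l', r', c') = {}"
    and \<tau>: "rule_subst \<tau> (l', r', c') = (u, v, d)"
    using ex_variant_apart[OF \<alpha>'(1) finite_rule_vars[of "(l, r, c)"], of \<R>] \<alpha>'(2,3)
    by (metis prod_cases3)
  define \<rho> where "\<rho> x = (if x \<in> rule_vars (l, r, c) then \<sigma> x else \<tau> x)" for x
  have \<rho>: "\<rho> \<in> substs \<R>" using rule(2) variant(2) by (simp add: substs_def \<rho>_def)
  have "rule_subst \<rho> (l, r, c) = rule_subst \<sigma> (l, r, c)"
    by (rule rule_subst_cong) (simp add: \<rho>_def)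
  moreover have "rule_subst \<rho> (l', r', c') = (u, v, d)"
    unfolding \<tau>[symmetric] using apart by (intro rule_subst_cong) (auto simp: \<rho>_def)
  moreover have act: "p \<in> active_pos (repl \<R>) l" using p by (simp add: active_fun_pos_def)
  then have "subst \<rho> (subt_at l p) = subst \<sigma> (subt_at l p)"
    using tvars_subt_at by (intro subst_cong) (fastforce simp: \<rho>_def)
  ultimately have "rule_subst \<rho> (replace_at l p r', r, bin Eq (subt_at l p) l' # c @ c') =
      (replace_at (subst \<sigma> l) p v, subst \<sigma> r,
       bin Eq (subst \<sigma> (subt_at l p)) u # map (asubst \<sigma>) c @ d)"
    by (simp add: subst_replace_at[OF act] asubst_bin)
  moreover have "(replace_at l p r', r, bin Eq (subt_at l p) l' # c @ c') \<in> lccps \<R> rs rs'"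
    unfolding lccps_def using rule(1) variant(1) apart p by blast
  ultimately show ?thesis
    unfolding crule_inst_def using \<rho> rule(3) eq \<alpha>'(4) by fastforce
qed

lemma crule_inst_cvps_ps:
  assumes rule: "(l, r, c) \<in> rs" "\<sigma> \<in> substs \<R>" "\<forall>B \<in> set c. D (asubst \<sigma> B)"
    and p: "p \<in> active_var_pos (repl \<R>) x l"
    and v: "D (bin RewPs (\<sigma> x) v)" "v \<in> terms \<R>"
  shows "crule_inst \<R> D (cvps_ps \<R> rs) (replace_at (subst \<sigma> l) p v) (subst \<sigma> r)"
proof -
  obtain x' where x': "x' \<notin> rule_vars (l, r, c)"
    using ex_new_if_finite[OF infinite_UNIV finite_rule_vars] by blast
  let ?\<rho> = "\<sigma>(x' := v)"
  have act: "p \<in> active_pos (repl \<R>) l" and "subt_at l p = Var x"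
    using p by (simp_all add: active_var_pos_def)
  then have "x \<noteq> x'" using tvars_subt_at[OF act] x' by auto
  moreover have "rule_subst ?\<rho> (l, r, c) = rule_subst \<sigma> (l, r, c)"
    using x' by (intro rule_subst_cong) auto
  ultimately have "rule_subst ?\<rho> (replace_at l p (Var x'), r, bin RewPs (Var x) (Var x') # c) =
      (replace_at (subst \<sigma> l) p v, subst \<sigma> r, bin RewPs (\<sigma> x) v # map (asubst \<sigma>) c)"
    by (simp add: subst_replace_at[OF act] asubst_bin)
  moreover have "(replace_at l p (Var x'), r, bin RewPs (Var x) (Var x') # c) \<in> cvps_ps \<R> rs"
    unfolding cvps_ps_def active_vars_def using rule(1) p x' by blast
  moreover have "?\<rho> \<in> substs \<R>" using rule(2) v(2) by (simp add: substs_def)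
  ultimately show ?thesis
    unfolding crule_inst_def using rule(3) v(1) by fastforce
qed

lemma critical_peak:
  assumes rule: "crule_inst \<R> ded rs s t" and step: "step_RE \<R> s e"
  shows "crule_inst \<R> ded (lccps \<R> rs (Rls_rm \<R>) \<union> cvps_ps \<R> rs) e t"
proof -
  from rule obtain l r c \<sigma> where inst: "(l, r, c) \<in> rs" "\<sigma> \<in> substs \<R>"
    "\<forall>B \<in> set c. ded (asubst \<sigma> B)" "s = subst \<sigma> l" "t = subst \<sigma> r"
    by (rule crule_instE)
  have "act_closure \<R> modulo_root_step (subst \<sigma> l) e"
    using step inst(4) by (simp add: step_RE_iff)
  then have "crule_inst \<R> ded (lccps \<R> rs (Rls_rm \<R>)) e t \<or> crule_inst \<R> ded (cvps_ps \<R> rs) e t"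
  proof (cases rule: act_closure_subst_cases)
    case (fun_pos p v)
    then obtain u where "equal (subst \<sigma> (subt_at l p)) u" "rule_root_step u v"
      unfolding modulo_root_step_def by blast
    then show ?thesis using crule_inst_lccps[OF inst(1-3) fun_pos(1)] fun_pos(3) inst(5) by simp
  next
    case (var_pos x p v)
    then have "ded (bin RewPs (\<sigma> x) v)" by (simp add: step_RE_iff[symmetric] step_RE_def)
    then show ?thesis
      using crule_inst_cvps_ps[OF inst(1-3) var_pos(1)] ded_bin_in_terms var_pos(3) inst(5) by simp
  qed
  then show ?thesis unfolding crule_inst_def by blast
qed

lemma crule_inst_joinable:
  assumes "\<forall>\<pi> \<in> rs. pair_joinable \<R> \<pi>" "crule_inst \<R> ded rs s t"
  shows "RE_joinable \<R> s t"
  using assms(2)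
proof (rule crule_instE)
  fix l r c \<sigma> assume inst: "(l, r, c) \<in> rs" "\<sigma> \<in> substs \<R>" "\<forall>B \<in> set c. ded (asubst \<sigma> B)"
    "s = subst \<sigma> l" "t = subst \<sigma> r"
  have "pair_joinable \<R> (l, r, c)" using assms(1) inst(1) by blast
  then show ?thesis using inst(2-5) by simp
qed

lemma act_closure_peak_cases:
  assumes st: "act_closure \<R> B s t" and su: "act_closure \<R> C s u"
    and in_terms: "t \<in> terms \<R>" "u \<in> terms \<R>"
  obtains (root_left) "B s t"
    | (root_right) "C s u"
    | (same_arg) f ts i t' u' where "s = Fun f ts" "Fun f ts \<in> terms \<R>" "i \<in> repl \<R> f"
      "act_closure \<R> B (ts ! i) t'" "t = Fun f (ts[i := t'])"
      "act_closure \<R> C (ts ! i) u'" "u = Fun f (ts[i := u'])"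
    | (disjoint_args) v where "act_closure \<R> C t v" "act_closure \<R> B u v"
  using st
proof (cases rule: act_closure.cases)
  case root
  then show ?thesis by (rule root_left)
next
  case left: (arg f ts i t')
  from su show ?thesis
  proof (cases rule: act_closure.cases)
    case root
    then show ?thesis by (rule root_right)
  next
    case (arg f' ts' j u')
    then have right: "j \<in> repl \<R> f" "act_closure \<R> C (ts ! j) u'" "u = Fun f (ts[j := u'])"
      using left(1) by simp_all
    show ?thesis
    proof (cases "i = j")
      case True
      then show ?thesis using same_arg left right by blast
    next
      case False
      have "act_closure \<R> C t (Fun f (ts[i := t', j := u']))"
        using in_terms(1) right(1,2) False unfolding left(2) by (intro act_closure.arg) auto
      moreover have "act_closure \<R> B u (Fun f (ts[j := u', i := t']))"
        using in_terms(2) left(4,5) False unfolding right(3) by (intro act_closure.arg) auto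
      ultimately show ?thesis using disjoint_args list_update_swap[OF False] by metis
    qed
  qed
qed

section \<open>Rewriting modulo \<open>E\<close> and active arguments\<close>

lemma active_arg_in_terms: "active_arg \<R> s u \<Longrightarrow> u \<in> terms \<R>"
proof (erule active_arg.cases)
  fix f ts i assume "Fun f ts \<in> terms \<R>" "i \<in> repl \<R> f" "u = ts ! i"
  then show "u \<in> terms \<R>" using nth_mem[OF repl_less[of f ts i]] by (auto simp: Fun_in_terms_iff)
qed

lemma wf_active_arg: "wf {(u, s). active_arg \<R> s u}"
proof (rule wf_subset[OF wf_measure[of size]])
  have "size (ts ! i) < size (Fun f ts)"
    if "i < length ts" for f :: 'f and ts :: "('f, 'v) trm list" and i
    using size_list_estimation'[OF nth_mem[OF that] order.refl, of size] by simp
  then show "{(u, s). active_arg \<R> s u} \<subseteq> measure size"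
    using repl_less by (auto elim!: active_arg.cases)
qed

lemma active_arg_step_RmodE:
  assumes "active_arg \<R> s u" "step_RmodE \<R> u v"
  shows "\<exists>t. step_RmodE \<R> s t \<and> active_arg \<R> t v"
  using assms(1)
proof cases
  case (arg f ts i)
  let ?t = "Fun f (ts[i := v])"
  have "v \<in> terms \<R>" using assms(2) ded_bin_in_terms by (auto simp: step_RmodE_def)
  then have "active_arg \<R> ?t (ts[i := v] ! i)"
    using arg by (intro active_arg.intros update_in_terms)
  moreover have "step_RmodE \<R> s ?t"
    using act_compatible_arg[OF act_compatible_step_RmodE arg(3,4)] assms(2) arg(1,2) by simp
  ultimately show ?thesis using repl_less[OF arg(3,4)] by auto
qed

lemma E_terminating_iff_wf: "E_terminating \<R> \<longleftrightarrow> wf {(t, s). step_RmodE \<R> s t}"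
  by (simp add: E_terminating_def wf_iff_no_infinite_down_chain)

lemma wf_step_RmodE_active_arg:
  assumes "E_terminating \<R>"
  shows "wf ({(t, s). step_RmodE \<R> s t} \<union> {(u, s). active_arg \<R> s u})"
proof (rule wf_Un_if_quasi_commute)
  show "wf {(t, s). step_RmodE \<R> s t}"
    using assms by (simp add: E_terminating_iff_wf)
  show "wf {(u, s). active_arg \<R> s u}" by (rule wf_active_arg)
  have "{(t, s). step_RmodE \<R> s t} O {(u, s). active_arg \<R> s u} \<subseteq>
      {(u, s). active_arg \<R> s u} O {(t, s). step_RmodE \<R> s t}"
    using active_arg_step_RmodE by blast
  then show "{(t, s). step_RmodE \<R> s t} O {(u, s). active_arg \<R> s u} \<subseteq>
      ({(t, s). step_RmodE \<R> s t} \<union> {(u, s). active_arg \<R> s u})\<^sup>* O {(t, s). step_RmodE \<R> s t}"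
    by blast
qed

end

section \<open>The Church--Rosser property modulo \<open>E\<close>\<close>

locale joinable_egtrs = wf_egtrs +
  assumes E_terminating: "E_terminating \<R>"
    and rule_pairs_joinable:
      "\<forall>\<pi> \<in> lccps \<R> (Rls_rm \<R>) (Rls_rm \<R>) \<union> cvps_ps \<R> (Rls_rm \<R>). pair_joinable \<R> \<pi>"
    and equation_pairs_joinable:
      "\<forall>\<pi> \<in> lccps \<R> (sym_rules \<R>) (Rls_rm \<R>) \<union> cvps_ps \<R> (sym_rules \<R>). pair_joinable \<R> \<pi>"
begin

lemma rule_root_peak: "rule_root_step s t \<Longrightarrow> step_RE \<R> s e \<Longrightarrow> RE_joinable \<R> e t"
  using crule_inst_joinable[OF rule_pairs_joinable] critical_peak by blast

lemma equation_root_peak: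
  "crule_inst \<R> ded (sym_rules \<R>) s t \<Longrightarrow> step_RE \<R> s e \<Longrightarrow> RE_joinable \<R> e t"
  using crule_inst_joinable[OF equation_pairs_joinable] critical_peak by blast

lemma E_step_peak:
  assumes "E_step s t" "step_RE \<R> s e"
  shows "RE_joinable \<R> e t"
  using assms
proof (induction s arbitrary: t e rule: wf_induct_rule[OF wf_active_arg, case_names less])
  case (less s)
  have st: "equal s t" using E_step_imp_equal less(2) .
  have "t \<in> terms \<R>" "e \<in> terms \<R>"
    using ded_bin_in_terms[OF st] step_RE_in_terms[OF less(3)] by blast+
  with less(2) less(3)[unfolded step_RE_iff] show ?case
  proof (cases rule: act_closure_peak_cases)
    case root_left
    then show ?thesis using equation_root_peak less(3) by blast
  next
    case root_right
    then have "modulo_root_step t e"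
      unfolding modulo_root_step_def using equal_sym[OF st] equal_trans by blast
    then have "step_RE \<R> t e" by (simp add: step_RE_iff act_closure.root)
    then show ?thesis using step_imp_joinable joinable_sym by blast
  next
    case (same_arg f ts i t' e')
    then have "RE_joinable \<R> e' t'"
      using less(1)[of "ts ! i"] active_arg.intros[OF same_arg(2,3)] by (simp add: step_RE_iff)
    then show ?thesis
      using act_compatibleD[OF act_compatible_RE_joinable same_arg(2,3)] same_arg(5,7) by simp
  next
    case (disjoint_args v)
    then have "step_RE \<R> t v" "equal e v" by (simp_all add: step_RE_iff E_step_imp_equal)
    then show ?thesis using steps_joinable[of e e t v] eqv_imp_joinable by blast
  qed
qed

sublocale locally_coherent equal "step_RE \<R>" E_step
  rewrites "rewriting_modulo.joinable equal (step_RE \<R>) = RE_joinable \<R>"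
    and "rewriting_modulo.step_mod equal (step_RE \<R>) = step_RmodE \<R>"
proof -
  have "wfp (step_RmodE \<R>)\<inverse>\<inverse>"
    using E_terminating by (simp add: E_terminating_iff_wf wfp_def)
  then show "locally_coherent equal (step_RE \<R>) E_step"
    using E_step_imp_equal equal_imp_E_steps E_step_peak
    by unfold_locales (simp_all add: joinable_eq_RE_joinable step_mod_eq_step_RmodE)
qed (rule joinable_eq_RE_joinable step_mod_eq_step_RmodE)+

lemma modulo_root_peak:
  assumes "reducts_confluent s" "modulo_root_step s d" "step_RE \<R> s e"
  shows "RE_joinable \<R> d e"
proof -
  obtain l where l: "equal s l" "rule_root_step l d"
    using assms(2) modulo_root_step_def by blast
  obtain e' where e': "step_RE \<R> l e'" "RE_joinable \<R> e e'"
    using coherence[OF assms(1) l(1) assms(3)] by blast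
  have "confluent_at e'"
    using reducts_confluentD[OF reducts_confluent_eqv[OF assms(1) l(1)] e'(1)] .
  then have "RE_joinable \<R> e d"
    using joinable_trans e'(2) rule_root_peak[OF l(2) e'(1)] by blast
  then show ?thesis by (rule joinable_sym)
qed

lemma local_confluence:
  assumes reducts: "reducts_confluent s" and args: "\<And>u. active_arg \<R> s u \<Longrightarrow> confluent_at u"
    and d: "step_RE \<R> s d" and e: "step_RE \<R> s e"
  shows "RE_joinable \<R> d e"
  using d[unfolded step_RE_iff] e[unfolded step_RE_iff]
    step_RE_in_terms[OF d, THEN conjunct2] step_RE_in_terms[OF e, THEN conjunct2]
proof (cases rule: act_closure_peak_cases)
  case root_left
  then show ?thesis using modulo_root_peak reducts e by blast
next
  case root_right
  then show ?thesis using modulo_root_peak reducts d joinable_sym by blast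
next
  case (same_arg f ts i d' e')
  have "confluent_at (ts ! i)"
    using args active_arg.intros[OF same_arg(2,3)] same_arg(1) by blast
  moreover have "step_RE \<R> (ts ! i) d'" "step_RE \<R> (ts ! i) e'"
    using same_arg by (simp_all add: step_RE_iff)
  ultimately have "RE_joinable \<R> d' e'"
    by (rule confluent_atD[OF _ step_imp_reaches step_imp_reaches])
  then show ?thesis
    using act_compatibleD[OF act_compatible_RE_joinable same_arg(2,3)] same_arg(5,7) by simp
next
  case (disjoint_args v)
  then have "step_RE \<R> d v" "step_RE \<R> e v" by (simp_all add: step_RE_iff)
  then show ?thesis
    using steps_joinable[of d v e v] eqv_imp_joinable equal_refl step_RE_in_terms by blast
qed

lemma confluent_at_term: "w \<in> terms \<R> \<Longrightarrow> confluent_at w"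
proof (induction w rule: wf_induct_rule[OF wf_step_RmodE_active_arg[OF E_terminating],
      case_names less])
  case (less w)
  have reducts: "reducts_confluent w"
    unfolding reducts_confluent_def
  proof (intro allI impI)
    fix d assume wd: "step_RmodE \<R> w d"
    then have "d \<in> terms \<R>" using ded_bin_in_terms by (auto simp: step_RmodE_def)
    then show "confluent_at d" using less(1) wd by blast
  qed
  have args: "confluent_at u" if "active_arg \<R> w u" for u
  proof -
    have "u \<in> terms \<R>" using that by (rule active_arg_in_terms)
    then show ?thesis using less(1) that by blast
  qed
  show ?case
    using reducts equal_refl[OF less(2)] local_confluence[OF reducts args]
    by (rule confluent_at_if_reducts_confluent)
qed

lemma church_rosser_mod_E: "church_rosser_mod_E \<R>"
  unfolding church_rosser_mod_E_def
proof (intro ballI impI)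
  fix t t' assume t: "t \<in> terms \<R>" and t': "(sup (step_E \<R>) (sup (step_R \<R>) (step_R \<R>)\<inverse>\<inverse>))\<^sup>*\<^sup>* t t'"
  have "sup (step_E \<R>) (sup (step_R \<R>) (step_R \<R>)\<inverse>\<inverse>) \<le> sup equal (sup (step_RE \<R>) (step_RE \<R>)\<inverse>\<inverse>)"
    using step_E_imp_equal step_R_imp_step_RE by blast
  then have "(sup equal (sup (step_RE \<R>) (step_RE \<R>)\<inverse>\<inverse>))\<^sup>*\<^sup>* t t'"
    using t' rtranclp_mono by blast
  then show "RE_joinable \<R> t t'"
    using church_rosser_if_confluent confluent_at_term equal_refl[OF t] ded_bin_in_terms by blast
qed

lemma E_confluent: "E_confluent \<R>"
  unfolding E_confluent_def
proof (intro ballI allI impI, elim conjE)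
  fix t t1 t2 assume t: "t \<in> terms \<R>"
    and t1: "(step_RmodE \<R>)\<^sup>*\<^sup>* t t1" and t2: "(step_RmodE \<R>)\<^sup>*\<^sup>* t t2"
  have "reaches s s'" if "(step_RmodE \<R>)\<^sup>*\<^sup>* s s'" for s s'
    using that by induction (blast intro: rtranclp_trans step_mod_imp_reaches)+
  then have "RE_joinable \<R> t1 t2" using confluent_atD[OF confluent_at_term[OF t]] t1 t2 by blast
  moreover have "(step_RE \<R>)\<^sup>*\<^sup>* \<le> (step_RmodE \<R>)\<^sup>*\<^sup>*"
    using step_imp_step_mod by (intro rtranclp_mono) blast
  ultimately show "\<exists>t1' t2'. (step_RmodE \<R>)\<^sup>*\<^sup>* t1 t1' \<and> (step_RmodE \<R>)\<^sup>*\<^sup>* t2 t2' \<and> eq_E \<R> t1' t2'"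
    unfolding RE_joinable_def by blast
qed

end

theorem theorem11p3:
  fixes \<R> :: "('p, 'f, 'v :: {countable, infinite}) egtrs"
  assumes "is_egtrs \<R>"
    and "E_terminating \<R>"
    and "\<forall>\<pi> \<in> LCCP_R \<R> \<union> CVP_ps_R \<R> \<union> LCCP_E_R \<R> \<union> CVP_ps_E \<R>. pair_joinable \<R> \<pi>"
  shows "church_rosser_mod_E \<R> \<and> E_confluent \<R>"
proof -
  interpret joinable_egtrs \<R>
    using assms unfolding LCCP_R_def CVP_ps_R_def LCCP_E_R_def CVP_ps_E_def
    by unfold_locales blast+
  show ?thesis using church_rosser_mod_E E_confluent by blast
qed

end
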